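(* Let $\mathcal{C}$ be a category with finite products equipped with a Rosický tangent structure $(T,\pi,0,+,\lambda,\tau)$. For $X,Y\in\mathcal{C}$ let $\chi_{X,Y}:=(T\mathrm{pr}_1,T\mathrm{pr}_2):T(X\times Y)\to TX\times TY$. The following are equivalent: (i) The tangent structure is cartesian. (ii) The natural transformation $\chi_{X,Y}:T(X\times Y)\to TX\times TY$ is a natural isomorphism, and the product functor $\mathcal{C}\times\mathcal{C}\to\mathcal{C}$, $(X,Y)\mapsto X\times Y$, together with $\alpha:=\chi^{-1}$, is a strong morphism of Rosický tangent categories.
   Context: **Rosický tangent structure.** A Rosický tangent structure on a category $\mathcal{C}$ consists of a functor $T:\mathcal{C}\to\mathcal{C}$ and natural transformations $\pi:T\to 1$, $0:1\to T$, $+:T_2\to T$, $\lambda:T\to T^2$, $\tau:T^2\to T^2$ such that for all objects $X$: (i) for all $k\ge1$ the fiber product $T_kX=TX\times_X\cdots\times_XTX$ of $k$ copies of $\pi_X:TX\to X$ exists and is preserved by $T$, i.e. the natural morphism $\nu_{k,X}:T(T_kX)\to T^2X\times_{TX}^{T\pi_X,T\pi_X}\cdots\times_{TX}^{T\pi_X,T\pi_X}T^2X$ is an isomorphism; (ii) $\pi_X:TX\to X$ with addition $+_X$ and zero $0_X$ is an abelian group object in the slice category $\mathcal{C}_{/X}$; (iii) $\tau_X\circ\tau_X=\mathrm{id}$, $\tau_{TX}\circ T\tau_X\circ\tau_{TX}=T\tau_X\circ\tau_{TX}\circ T\tau_X$, $\pi_{TX}\circ\tau_X=T\pi_X$, and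 $+_{TX}\circ(\tau_X\times_{TX}\tau_X)=\tau_X\circ T(+_X)\circ\nu_{2,X}^{-1}$ on $T^2X\times_{TX}^{T\pi_X,T\pi_X}T^2X$; (iv) $\pi_{TX}\circ\lambda_X=0_X\circ\pi_X$, $\lambda_{TX}\circ\lambda_X=T\lambda_X\circ\lambda_X$, and $+_{TX}\circ(\lambda_X\times_{0_X}\lambda_X)=\lambda_X\circ+_X$; (v) $\tau_X\circ\lambda_X=\lambda_X$ and $T\tau_X\circ\tau_{TX}\circ T\lambda_X=\lambda_{TX}\circ\tau_X$; (vi) the commutative square $(\pi_{TX},T\pi_X)\circ\lambda_X=(0_X,0_X)\circ\pi_X:TX\to T_2X$ is a pullback square (of $(\pi_{TX},T\pi_X):T^2X\to T_2X$ along $(0_X,0_X):X\to T_2X$). A category with a Rosický tangent structure is called a Rosický tangent category. **Cartesian.** A tangent structure on a category with finite products is cartesian if $T$ preserves finite products, i.e. $\chi_{X,Y}$ has an inverse for all $X,Y$. **Strong morphism.** Let $(\mathcal{C},T,\pi,0,+,\lambda,\tau)$ and $(\mathcal{C}',T',\pi',0',+',\lambda',\tau')$ be Rosický tangent categories. A strong morphism is a functor $F:\mathcal{C}\to\mathcal{C}'$ with a natural isomorphism $\alpha:FT\to T'F$ such that for all $X\in\mathcal{C}$: (a) $F$ preserves the finite fiber products of the tangent bundle: for all $k\ge1$ the natural morphism $\nu_{k}:F(T_kX)\to FTX\times_{FX}^{F\pi_X,F\pi_X}\cdots\times_{FX}^{F\pi_X,F\pi_X}FTX$ ($k$ factors)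 is an isomorphism; (b) $\pi'_{FX}\circ\alpha_X=F\pi_X$ and $+'_{FX}\circ(\alpha_X\times_{FX}\alpha_X)\circ\nu_2=\alpha_X\circ F(+_X)$; (c) $\tau'_{FX}\circ T'\alpha_X\circ\alpha_{TX}=T'\alpha_X\circ\alpha_{TX}\circ F\tau_X$ and $\lambda'_{FX}\circ\alpha_X=T'\alpha_X\circ\alpha_{TX}\circ F\lambda_X$. **Product.** The category $\mathcal{C}\times\mathcal{C}$ carries the tangent structure given by the products of the tangent functors and of the structure natural transformations (componentwise). *)

theory Defs
  imports Main
begin

section \<open>Categories, functors, natural transformations\<close>

record ('o, 'a) cat =
  Ob :: "'o set"
  Ar :: "'a set"
  Dom :: "'a \<Rightarrow> 'o"
  Cod :: "'a \<Rightarrow> 'o"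
  Idn :: "'o \<Rightarrow> 'a"
  Cmp :: "'a \<Rightarrow> 'a \<Rightarrow> 'a"  (infixr \<open>\<cdot>\<index>\<close> 70)

definition hom :: "('o, 'a) cat \<Rightarrow> 'o \<Rightarrow> 'o \<Rightarrow> 'a set" where
  "hom C X Y = {f \<in> Ar C. Dom C f = X \<and> Cod C f = Y}"

locale category =
  fixes C :: "('o, 'a) cat" (structure)
  assumes dom_ob: "f \<in> Ar C \<Longrightarrow> Dom C f \<in> Ob C"
    and cod_ob: "f \<in> Ar C \<Longrightarrow> Cod C f \<in> Ob C"
    and idn_hom: "X \<in> Ob C \<Longrightarrow> Idn C X \<in> hom C X X"
    and cmp_hom: "f \<in> hom C X Y \<Longrightarrow> g \<in> hom C Y Z \<Longrightarrow> g \<cdot> f \<in> hom C X Z"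
    and idn_left: "f \<in> hom C X Y \<Longrightarrow> Idn C Y \<cdot> f = f"
    and idn_right: "f \<in> hom C X Y \<Longrightarrow> f \<cdot> Idn C X = f"
    and assoc: "f \<in> hom C W X \<Longrightarrow> g \<in> hom C X Y \<Longrightarrow> h \<in> hom C Y Z
      \<Longrightarrow> (h \<cdot> g) \<cdot> f = h \<cdot> (g \<cdot> f)"

definition inverse_arrows :: "('o, 'a) cat \<Rightarrow> 'a \<Rightarrow> 'a \<Rightarrow> bool" where
  "inverse_arrows C f g \<longleftrightarrow>
     f \<in> Ar C \<and> g \<in> hom C (Cod C f) (Dom C f)
     \<and> g \<cdot>\<^bsub>C\<^esub> f = Idn C (Dom C f) \<and> f \<cdot>\<^bsub>C\<^esub> g = Idn C (Cod C f)"

definition is_iso :: "('o, 'a) cat \<Rightarrow> 'a \<Rightarrow> bool" where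
  "is_iso C f \<longleftrightarrow> (\<exists>g. inverse_arrows C f g)"

definition inv_arr :: "('o, 'a) cat \<Rightarrow> 'a \<Rightarrow> 'a" where
  "inv_arr C f = (THE g. inverse_arrows C f g)"

record ('o, 'a, 'p, 'b) funct =
  FOb :: "'o \<Rightarrow> 'p"
  FAr :: "'a \<Rightarrow> 'b"

definition is_functor :: "('o, 'a) cat \<Rightarrow> ('p, 'b) cat \<Rightarrow> ('o, 'a, 'p, 'b) funct \<Rightarrow> bool" where
  "is_functor C D F \<longleftrightarrow>
     category C \<and> category D
     \<and> (\<forall>X \<in> Ob C. FOb F X \<in> Ob D)
     \<and> (\<forall>f \<in> Ar C. FAr F f \<in> hom D (FOb F (Dom C f)) (FOb F (Cod C f)))
     \<and> (\<forall>X \<in> Ob C. FAr F (Idn C X) = Idn D (FOb F X))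
     \<and> (\<forall>f \<in> Ar C. \<forall>g \<in> Ar C. Cod C f = Dom C g \<longrightarrow>
          FAr F (g \<cdot>\<^bsub>C\<^esub> f) = FAr F g \<cdot>\<^bsub>D\<^esub> FAr F f)"

definition id_funct :: "('o, 'a, 'o, 'a) funct" where
  "id_funct = \<lparr>FOb = (\<lambda>X. X), FAr = (\<lambda>f. f)\<rparr>"

definition comp_funct ::
  "('p, 'b, 'q, 'c) funct \<Rightarrow> ('o, 'a, 'p, 'b) funct \<Rightarrow> ('o, 'a, 'q, 'c) funct" where
  "comp_funct G F = \<lparr>FOb = (\<lambda>X. FOb G (FOb F X)), FAr = (\<lambda>f. FAr G (FAr F f))\<rparr>"

definition nat_trans :: "('o, 'a) cat \<Rightarrow> ('p, 'b) cat \<Rightarrow>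
    ('o, 'a, 'p, 'b) funct \<Rightarrow> ('o, 'a, 'p, 'b) funct \<Rightarrow> ('o \<Rightarrow> 'b) \<Rightarrow> bool" where
  "nat_trans C D F G \<alpha> \<longleftrightarrow>
     is_functor C D F \<and> is_functor C D G
     \<and> (\<forall>X \<in> Ob C. \<alpha> X \<in> hom D (FOb F X) (FOb G X))
     \<and> (\<forall>f \<in> Ar C. \<alpha> (Cod C f) \<cdot>\<^bsub>D\<^esub> FAr F f = FAr G f \<cdot>\<^bsub>D\<^esub> \<alpha> (Dom C f))"

definition nat_iso :: "('o, 'a) cat \<Rightarrow> ('p, 'b) cat \<Rightarrow>
    ('o, 'a, 'p, 'b) funct \<Rightarrow> ('o, 'a, 'p, 'b) funct \<Rightarrow> ('o \<Rightarrow> 'b) \<Rightarrow> bool" where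
  "nat_iso C D F G \<alpha> \<longleftrightarrow> nat_trans C D F G \<alpha> \<and> (\<forall>X \<in> Ob C. is_iso D (\<alpha> X))"

definition prod_cat :: "('o, 'a) cat \<Rightarrow> ('p, 'b) cat \<Rightarrow> ('o \<times> 'p, 'a \<times> 'b) cat" where
  "prod_cat C D =
     \<lparr>Ob = Ob C \<times> Ob D, Ar = Ar C \<times> Ar D,
      Dom = (\<lambda>(f, g). (Dom C f, Dom D g)), Cod = (\<lambda>(f, g). (Cod C f, Cod D g)),
      Idn = (\<lambda>(X, Y). (Idn C X, Idn D Y)),
      Cmp = (\<lambda>(f', g') (f, g). (f' \<cdot>\<^bsub>C\<^esub> f, g' \<cdot>\<^bsub>D\<^esub> g))\<rparr>"

definition prod_funct :: "('o, 'a, 'o', 'a') funct \<Rightarrow> ('p, 'b, 'p', 'b') funct \<Rightarrow>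
    ('o \<times> 'p, 'a \<times> 'b, 'o' \<times> 'p', 'a' \<times> 'b') funct" where
  "prod_funct F G =
     \<lparr>FOb = (\<lambda>(X, Y). (FOb F X, FOb G Y)), FAr = (\<lambda>(f, g). (FAr F f, FAr G g))\<rparr>"


section \<open>Fibre products\<close>

text \<open>Cones and limit cones over \<open>k\<close> copies of one arrow \<open>f : A \<rightarrow> B\<close>: the legs are
  \<open>p 0, \<dots>, p (k - 1) : P \<rightarrow> A\<close>, and the values \<open>p i\<close> for \<open>i \<ge> k\<close> are irrelevant.  The notions
  are only used for \<open>k \<ge> 1\<close>; no leg to \<open>B\<close> is recorded, so \<open>k = 0\<close> would be a terminal
  object of the whole category rather than \<open>B\<close>.\<close>

definition fibre_cone :: "('o, 'a) cat \<Rightarrow> nat \<Rightarrow> 'a \<Rightarrow> 'o \<Rightarrow> (nat \<Rightarrow> 'a) \<Rightarrow> bool" where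
  "fibre_cone C k f P p \<longleftrightarrow>
     f \<in> Ar C \<and> P \<in> Ob C \<and> (\<forall>i<k. p i \<in> hom C P (Dom C f))
     \<and> (\<forall>i<k. \<forall>j<k. f \<cdot>\<^bsub>C\<^esub> p i = f \<cdot>\<^bsub>C\<^esub> p j)"

definition is_fibre_power :: "('o, 'a) cat \<Rightarrow> nat \<Rightarrow> 'a \<Rightarrow> 'o \<Rightarrow> (nat \<Rightarrow> 'a) \<Rightarrow> bool" where
  "is_fibre_power C k f P p \<longleftrightarrow>
     fibre_cone C k f P p
     \<and> (\<forall>Q q. fibre_cone C k f Q q \<longrightarrow>
          (\<exists>!h. h \<in> hom C Q P \<and> (\<forall>i<k. p i \<cdot>\<^bsub>C\<^esub> h = q i)))"

text \<open>The arrow \<open>Q \<rightarrow> P\<close> into the fibre product \<open>(P, p)\<close> with components \<open>q 0, \<dots>, q (k - 1)\<close>.\<close>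

definition induced ::
  "('o, 'a) cat \<Rightarrow> nat \<Rightarrow> 'o \<Rightarrow> (nat \<Rightarrow> 'a) \<Rightarrow> 'o \<Rightarrow> (nat \<Rightarrow> 'a) \<Rightarrow> 'a" where
  "induced C k P p Q q = (THE h. h \<in> hom C Q P \<and> (\<forall>i<k. p i \<cdot>\<^bsub>C\<^esub> h = q i))"

definition fib_pair :: "('o, 'a) cat \<Rightarrow> 'o \<Rightarrow> (nat \<Rightarrow> 'a) \<Rightarrow> 'a \<Rightarrow> 'a \<Rightarrow> 'a" where
  "fib_pair C P p u v = induced C 2 P p (Dom C u) (\<lambda>i. if i = 0 then u else v)"

text \<open>\<open>fib_map C k g Q q P p : Q \<rightarrow> P\<close> is \<open>g \<times> \<dots> \<times> g\<close> (\<open>k\<close> factors) from the fibre product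
  \<open>(Q, q)\<close> to the fibre product \<open>(P, p)\<close>.\<close>

definition fib_map :: "('o, 'a) cat \<Rightarrow> nat \<Rightarrow> 'a \<Rightarrow>
    'o \<Rightarrow> (nat \<Rightarrow> 'a) \<Rightarrow> 'o \<Rightarrow> (nat \<Rightarrow> 'a) \<Rightarrow> 'a" where
  "fib_map C k g Q q P p = induced C k P p Q (\<lambda>i. g \<cdot>\<^bsub>C\<^esub> q i)"

text \<open>The natural morphism \<open>\<nu>\<^sub>k : F P \<rightarrow> Q\<close> for a fibre product \<open>(P, p)\<close> of \<open>k\<close> copies of
  \<open>f\<close> and a fibre product \<open>(Q, q)\<close> of \<open>k\<close> copies of \<open>F f\<close> in the target category \<open>D\<close>.\<close>

definition nu :: "('p, 'b) cat \<Rightarrow> ('o, 'a, 'p, 'b) funct \<Rightarrow> nat \<Rightarrow>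
    'o \<Rightarrow> (nat \<Rightarrow> 'a) \<Rightarrow> 'p \<Rightarrow> (nat \<Rightarrow> 'b) \<Rightarrow> 'b" where
  "nu D F k P p Q q = induced D k Q q (FOb F P) (\<lambda>i. FAr F (p i))"

definition preserves_fibre_power :: "('p, 'b) cat \<Rightarrow> ('o, 'a, 'p, 'b) funct \<Rightarrow> nat \<Rightarrow>
    'a \<Rightarrow> 'o \<Rightarrow> (nat \<Rightarrow> 'a) \<Rightarrow> bool" where
  "preserves_fibre_power D F k f P p \<longleftrightarrow>
     (\<exists>Q q. is_fibre_power D k (FAr F f) Q q)
     \<and> (\<forall>Q q. is_fibre_power D k (FAr F f) Q q \<longrightarrow> is_iso D (nu D F k P p Q q))"

text \<open>The square \<open>f \<circ> u = g \<circ> v\<close> is a pullback, with \<open>u : P \<rightarrow> Dom f\<close> and \<open>v : P \<rightarrow> Dom g\<close>.\<close>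

definition is_pullback :: "('o, 'a) cat \<Rightarrow> 'a \<Rightarrow> 'a \<Rightarrow> 'o \<Rightarrow> 'a \<Rightarrow> 'a \<Rightarrow> bool" where
  "is_pullback C f g P u v \<longleftrightarrow>
     f \<in> Ar C \<and> g \<in> Ar C \<and> Cod C f = Cod C g
     \<and> u \<in> hom C P (Dom C f) \<and> v \<in> hom C P (Dom C g) \<and> f \<cdot>\<^bsub>C\<^esub> u = g \<cdot>\<^bsub>C\<^esub> v
     \<and> (\<forall>Q \<in> Ob C. \<forall>u' \<in> hom C Q (Dom C f). \<forall>v' \<in> hom C Q (Dom C g).
          f \<cdot>\<^bsub>C\<^esub> u' = g \<cdot>\<^bsub>C\<^esub> v' \<longrightarrow>
          (\<exists>!h. h \<in> hom C Q P \<and> u \<cdot>\<^bsub>C\<^esub> h = u' \<and> v \<cdot>\<^bsub>C\<^esub> h = v'))"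

text \<open>\<open>f : A \<rightarrow> B\<close> is an abelian group object in the slice category over \<open>B\<close>, with addition
  \<open>a\<close> and zero \<open>z\<close>.  In the slice, the terminal object is the identity of \<open>B\<close>, and the binary
  and ternary powers of \<open>f\<close> are the fibre products \<open>(P, p)\<close> and \<open>(P3, r)\<close> of two and three
  copies of \<open>f\<close>.\<close>

definition abelian_group_over :: "('o, 'a) cat \<Rightarrow> 'a \<Rightarrow> 'o \<Rightarrow> (nat \<Rightarrow> 'a) \<Rightarrow>
    'o \<Rightarrow> (nat \<Rightarrow> 'a) \<Rightarrow> 'a \<Rightarrow> 'a \<Rightarrow> bool" where
  "abelian_group_over C f P p P3 r a z \<longleftrightarrow>
     is_fibre_power C 2 f P p \<and> is_fibre_power C 3 f P3 r
     \<and> a \<in> hom C P (Dom C f) \<and> f \<cdot>\<^bsub>C\<^esub> a = f \<cdot>\<^bsub>C\<^esub> p 0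
     \<and> z \<in> hom C (Cod C f) (Dom C f) \<and> f \<cdot>\<^bsub>C\<^esub> z = Idn C (Cod C f)
     \<and> a \<cdot>\<^bsub>C\<^esub> fib_pair C P p (a \<cdot>\<^bsub>C\<^esub> fib_pair C P p (r 0) (r 1)) (r 2)
         = a \<cdot>\<^bsub>C\<^esub> fib_pair C P p (r 0) (a \<cdot>\<^bsub>C\<^esub> fib_pair C P p (r 1) (r 2))
     \<and> a \<cdot>\<^bsub>C\<^esub> fib_pair C P p (p 1) (p 0) = a
     \<and> a \<cdot>\<^bsub>C\<^esub> fib_pair C P p (z \<cdot>\<^bsub>C\<^esub> f) (Idn C (Dom C f)) = Idn C (Dom C f)
     \<and> (\<exists>n. n \<in> hom C (Dom C f) (Dom C f) \<and> f \<cdot>\<^bsub>C\<^esub> n = f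
          \<and> a \<cdot>\<^bsub>C\<^esub> fib_pair C P p n (Idn C (Dom C f)) = z \<cdot>\<^bsub>C\<^esub> f)"


section \<open>Rosicky tangent structures\<close>

text \<open>A choice of the fibre products \<open>T\<^sub>k X\<close> (object \<open>tpow T k X\<close>, projections
  \<open>tpr T k X 0, \<dots>, tpr T k X (k - 1)\<close> to \<open>T X\<close>) belongs to the data, since the source of the
  addition is the chosen \<open>T\<^sub>2 X\<close>.\<close>

record ('o, 'a) tangent =
  tfun :: "('o, 'a, 'o, 'a) funct"
  tpow :: "nat \<Rightarrow> 'o \<Rightarrow> 'o"
  tpr :: "nat \<Rightarrow> 'o \<Rightarrow> nat \<Rightarrow> 'a"
  tproj :: "'o \<Rightarrow> 'a"
  tzero :: "'o \<Rightarrow> 'a"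
  tadd :: "'o \<Rightarrow> 'a"
  tlift :: "'o \<Rightarrow> 'a"
  tflip :: "'o \<Rightarrow> 'a"

abbreviation TOb :: "('o, 'a) tangent \<Rightarrow> 'o \<Rightarrow> 'o" where
  "TOb T X \<equiv> FOb (tfun T) X"

abbreviation TAr :: "('o, 'a) tangent \<Rightarrow> 'a \<Rightarrow> 'a" where
  "TAr T f \<equiv> FAr (tfun T) f"

definition tpow_funct :: "('o, 'a) cat \<Rightarrow> ('o, 'a) tangent \<Rightarrow> nat \<Rightarrow> ('o, 'a, 'o, 'a) funct" where
  "tpow_funct C T k =
     \<lparr>FOb = tpow T k,
      FAr = (\<lambda>f. fib_map C k (TAr T f) (tpow T k (Dom C f)) (tpr T k (Dom C f))
                                       (tpow T k (Cod C f)) (tpr T k (Cod C f)))\<rparr>"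

locale rosicky_tangent_category = category C
  for C :: "('o, 'a) cat" (structure) +
  fixes T :: "('o, 'a) tangent"
  assumes functor_T: "is_functor C C (tfun T)"
    and nat_proj: "nat_trans C C (tfun T) id_funct (tproj T)"
    and nat_zero: "nat_trans C C id_funct (tfun T) (tzero T)"
    and nat_add: "nat_trans C C (tpow_funct C T 2) (tfun T) (tadd T)"
    and nat_lift: "nat_trans C C (tfun T) (comp_funct (tfun T) (tfun T)) (tlift T)"
    and nat_flip: "nat_trans C C (comp_funct (tfun T) (tfun T)) (comp_funct (tfun T) (tfun T)) (tflip T)"
    \<comment> \<open>(i)\<close>
    and pow_fibre_power: "X \<in> Ob C \<Longrightarrow> 1 \<le> k \<Longrightarrow>
      is_fibre_power C k (tproj T X) (tpow T k X) (tpr T k X)"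
    and pow_preserved: "X \<in> Ob C \<Longrightarrow> 1 \<le> k \<Longrightarrow>
      preserves_fibre_power C (tfun T) k (tproj T X) (tpow T k X) (tpr T k X)"
    \<comment> \<open>(ii)\<close>
    and abelian_group: "X \<in> Ob C \<Longrightarrow>
      abelian_group_over C (tproj T X) (tpow T 2 X) (tpr T 2 X) (tpow T 3 X) (tpr T 3 X)
        (tadd T X) (tzero T X)"
    \<comment> \<open>(iii)\<close>
    and flip_flip: "X \<in> Ob C \<Longrightarrow> tflip T X \<cdot> tflip T X = Idn C (TOb T (TOb T X))"
    and flip_braid: "X \<in> Ob C \<Longrightarrow>
      tflip T (TOb T X) \<cdot> TAr T (tflip T X) \<cdot> tflip T (TOb T X)
        = TAr T (tflip T X) \<cdot> tflip T (TOb T X) \<cdot> TAr T (tflip T X)"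
    and proj_flip: "X \<in> Ob C \<Longrightarrow> tproj T (TOb T X) \<cdot> tflip T X = TAr T (tproj T X)"
    and add_flip: "X \<in> Ob C \<Longrightarrow> is_fibre_power C 2 (TAr T (tproj T X)) Q q \<Longrightarrow>
      tadd T (TOb T X) \<cdot> fib_map C 2 (tflip T X) Q q (tpow T 2 (TOb T X)) (tpr T 2 (TOb T X))
        = tflip T X \<cdot> TAr T (tadd T X)
            \<cdot> inv_arr C (nu C (tfun T) 2 (tpow T 2 X) (tpr T 2 X) Q q)"
    \<comment> \<open>(iv)\<close>
    and proj_lift: "X \<in> Ob C \<Longrightarrow> tproj T (TOb T X) \<cdot> tlift T X = tzero T X \<cdot> tproj T X"
    and lift_lift: "X \<in> Ob C \<Longrightarrow>
      tlift T (TOb T X) \<cdot> tlift T X = TAr T (tlift T X) \<cdot> tlift T X"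
    and add_lift: "X \<in> Ob C \<Longrightarrow>
      tadd T (TOb T X) \<cdot> fib_map C 2 (tlift T X) (tpow T 2 X) (tpr T 2 X)
                                    (tpow T 2 (TOb T X)) (tpr T 2 (TOb T X))
        = tlift T X \<cdot> tadd T X"
    \<comment> \<open>(v)\<close>
    and flip_lift: "X \<in> Ob C \<Longrightarrow> tflip T X \<cdot> tlift T X = tlift T X"
    and flip_T_lift: "X \<in> Ob C \<Longrightarrow>
      TAr T (tflip T X) \<cdot> tflip T (TOb T X) \<cdot> TAr T (tlift T X)
        = tlift T (TOb T X) \<cdot> tflip T X"
    \<comment> \<open>(vi)\<close>
    and lift_pullback: "X \<in> Ob C \<Longrightarrow>
      is_pullback C
        (fib_pair C (tpow T 2 X) (tpr T 2 X) (tproj T (TOb T X)) (TAr T (tproj T X)))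
        (fib_pair C (tpow T 2 X) (tpr T 2 X) (tzero T X) (tzero T X))
        (TOb T X) (tlift T X) (tproj T X)"

definition prod_tangent ::
  "('o, 'a) tangent \<Rightarrow> ('p, 'b) tangent \<Rightarrow> ('o \<times> 'p, 'a \<times> 'b) tangent" where
  "prod_tangent S T =
     \<lparr>tfun = prod_funct (tfun S) (tfun T),
      tpow = (\<lambda>k (X, Y). (tpow S k X, tpow T k Y)),
      tpr = (\<lambda>k (X, Y) i. (tpr S k X i, tpr T k Y i)),
      tproj = (\<lambda>(X, Y). (tproj S X, tproj T Y)),
      tzero = (\<lambda>(X, Y). (tzero S X, tzero T Y)),
      tadd = (\<lambda>(X, Y). (tadd S X, tadd T Y)),
      tlift = (\<lambda>(X, Y). (tlift S X, tlift T Y)),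
      tflip = (\<lambda>(X, Y). (tflip S X, tflip T Y))\<rparr>"

locale strong_morphism =
  source: rosicky_tangent_category C T + target: rosicky_tangent_category C' T'
  for C :: "('o, 'a) cat" and T :: "('o, 'a) tangent"
    and C' :: "('p, 'b) cat" and T' :: "('p, 'b) tangent" +
  fixes F :: "('o, 'a, 'p, 'b) funct" and \<alpha> :: "'o \<Rightarrow> 'b"
  assumes functor_F: "is_functor C C' F"
    and nat_iso_\<alpha>: "nat_iso C C' (comp_funct F (tfun T)) (comp_funct (tfun T') F) \<alpha>"
    \<comment> \<open>(a)\<close>
    and F_preserves: "X \<in> Ob C \<Longrightarrow> 1 \<le> k \<Longrightarrow>
      preserves_fibre_power C' F k (tproj T X) (tpow T k X) (tpr T k X)"
    \<comment> \<open>(b)\<close>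
    and proj_\<alpha>: "X \<in> Ob C \<Longrightarrow> tproj T' (FOb F X) \<cdot>\<^bsub>C'\<^esub> \<alpha> X = FAr F (tproj T X)"
    and add_\<alpha>: "X \<in> Ob C \<Longrightarrow> is_fibre_power C' 2 (FAr F (tproj T X)) Q q \<Longrightarrow>
      tadd T' (FOb F X)
          \<cdot>\<^bsub>C'\<^esub> fib_map C' 2 (\<alpha> X) Q q (tpow T' 2 (FOb F X)) (tpr T' 2 (FOb F X))
          \<cdot>\<^bsub>C'\<^esub> nu C' F 2 (tpow T 2 X) (tpr T 2 X) Q q
        = \<alpha> X \<cdot>\<^bsub>C'\<^esub> FAr F (tadd T X)"
    \<comment> \<open>(c)\<close>
    and flip_\<alpha>: "X \<in> Ob C \<Longrightarrow>
      tflip T' (FOb F X) \<cdot>\<^bsub>C'\<^esub> TAr T' (\<alpha> X) \<cdot>\<^bsub>C'\<^esub> \<alpha> (TOb T X)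
        = TAr T' (\<alpha> X) \<cdot>\<^bsub>C'\<^esub> \<alpha> (TOb T X) \<cdot>\<^bsub>C'\<^esub> FAr F (tflip T X)"
    and lift_\<alpha>: "X \<in> Ob C \<Longrightarrow>
      tlift T' (FOb F X) \<cdot>\<^bsub>C'\<^esub> \<alpha> X
        = TAr T' (\<alpha> X) \<cdot>\<^bsub>C'\<^esub> \<alpha> (TOb T X) \<cdot>\<^bsub>C'\<^esub> FAr F (tlift T X)"


section \<open>Finite products and cartesian tangent structures\<close>

record ('o, 'a) products =
  pob :: "'o \<Rightarrow> 'o \<Rightarrow> 'o"
  pr1 :: "'o \<Rightarrow> 'o \<Rightarrow> 'a"
  pr2 :: "'o \<Rightarrow> 'o \<Rightarrow> 'a"
  unit_ob :: "'o"

definition is_terminal :: "('o, 'a) cat \<Rightarrow> 'o \<Rightarrow> bool" where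
  "is_terminal C Z \<longleftrightarrow> Z \<in> Ob C \<and> (\<forall>X \<in> Ob C. \<exists>!f. f \<in> hom C X Z)"

definition is_product :: "('o, 'a) cat \<Rightarrow> 'o \<Rightarrow> 'o \<Rightarrow> 'o \<Rightarrow> 'a \<Rightarrow> 'a \<Rightarrow> bool" where
  "is_product C X Y P p q \<longleftrightarrow>
     P \<in> Ob C \<and> p \<in> hom C P X \<and> q \<in> hom C P Y
     \<and> (\<forall>Z \<in> Ob C. \<forall>u \<in> hom C Z X. \<forall>v \<in> hom C Z Y.
          \<exists>!h. h \<in> hom C Z P \<and> p \<cdot>\<^bsub>C\<^esub> h = u \<and> q \<cdot>\<^bsub>C\<^esub> h = v)"

locale category_with_finite_products = category C
  for C :: "('o, 'a) cat" +
  fixes P :: "('o, 'a) products"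
  assumes binary_product: "X \<in> Ob C \<Longrightarrow> Y \<in> Ob C \<Longrightarrow>
      is_product C X Y (pob P X Y) (pr1 P X Y) (pr2 P X Y)"
    and terminal_one: "is_terminal C (unit_ob P)"

definition prod_pair :: "('o, 'a) cat \<Rightarrow> ('o, 'a) products \<Rightarrow> 'a \<Rightarrow> 'a \<Rightarrow> 'a" where
  "prod_pair C P u v =
     (THE h. h \<in> hom C (Dom C u) (pob P (Cod C u) (Cod C v))
        \<and> pr1 P (Cod C u) (Cod C v) \<cdot>\<^bsub>C\<^esub> h = u \<and> pr2 P (Cod C u) (Cod C v) \<cdot>\<^bsub>C\<^esub> h = v)"

definition product_functor ::
  "('o, 'a) cat \<Rightarrow> ('o, 'a) products \<Rightarrow> ('o \<times> 'o, 'a \<times> 'a, 'o, 'a) funct" where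
  "product_functor C P =
     \<lparr>FOb = (\<lambda>(X, Y). pob P X Y),
      FAr = (\<lambda>(f, g). prod_pair C P (f \<cdot>\<^bsub>C\<^esub> pr1 P (Dom C f) (Dom C g))
                                     (g \<cdot>\<^bsub>C\<^esub> pr2 P (Dom C f) (Dom C g)))\<rparr>"

definition chi :: "('o, 'a) cat \<Rightarrow> ('o, 'a) products \<Rightarrow> ('o, 'a) tangent \<Rightarrow> 'o \<times> 'o \<Rightarrow> 'a" where
  "chi C P T = (\<lambda>(X, Y). prod_pair C P (TAr T (pr1 P X Y)) (TAr T (pr2 P X Y)))"

text \<open>The tangent functor preserves finite products, i.e. binary products and the terminal
  object.  For a tangent structure the second part follows from the first, see
  \<open>cartesian_iff_chi_iso\<close> below.\<close>

definition cartesian_tangent :: "('o, 'a) cat \<Rightarrow> ('o, 'a) products \<Rightarrow> ('o, 'a) tangent \<Rightarrow> bool" where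
  "cartesian_tangent C P T \<longleftrightarrow>
     (\<forall>X \<in> Ob C. \<forall>Y \<in> Ob C. is_iso C (chi C P T (X, Y)))
     \<and> is_terminal C (TOb T (unit_ob P))"

lemma cartesian_iff_chi_iso:
  assumes "category_with_finite_products C P" and "rosicky_tangent_category C T"
  shows "cartesian_tangent C P T \<longleftrightarrow> (\<forall>X \<in> Ob C. \<forall>Y \<in> Ob C. is_iso C (chi C P T (X, Y)))"
proof -
  interpret category_with_finite_products C P by fact
  interpret rosicky_tangent_category C T by fact
  have "is_terminal C (TOb T (unit_ob P))"
    if iso: "\<forall>X \<in> Ob C. \<forall>Y \<in> Ob C. is_iso C (chi C P T (X, Y))"
  proof -
    define I where "I = unit_ob P"
    define p where "p = pr1 P I I"
    define q where "q = pr2 P I I"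
    define J where "J = TOb T I"
    have I: "I \<in> Ob C" "\<And>X. X \<in> Ob C \<Longrightarrow> \<exists>!f. f \<in> hom C X I"
      using terminal_one by (auto simp: is_terminal_def I_def)
    have pr: "is_product C I I (pob P I I) p q"
      using binary_product I(1) by (simp add: p_def q_def)
    then have "p = q" using I(2) unfolding is_product_def by metis
    have J: "J \<in> Ob C" using functor_T I(1) by (simp add: is_functor_def J_def)
    have prJ: "is_product C J J (pob P J J) (pr1 P J J) (pr2 P J J)"
      using binary_product J by simp
    have Tp: "TAr T p \<in> hom C (TOb T (pob P I I)) J"
      using functor_T pr by (auto simp: is_functor_def is_product_def hom_def J_def)
    have S: "TOb T (pob P I I) \<in> Ob C"
      using functor_T pr by (auto simp: is_functor_def is_product_def)
    define x where "x = chi C P T (I, I)"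
    have ex: "\<exists>!h. h \<in> hom C (TOb T (pob P I I)) (pob P J J)
        \<and> pr1 P J J \<cdot>\<^bsub>C\<^esub> h = TAr T p \<and> pr2 P J J \<cdot>\<^bsub>C\<^esub> h = TAr T p"
      using prJ S Tp unfolding is_product_def by blast
    have xdef: "x = (THE h. h \<in> hom C (TOb T (pob P I I)) (pob P J J)
        \<and> pr1 P J J \<cdot>\<^bsub>C\<^esub> h = TAr T p \<and> pr2 P J J \<cdot>\<^bsub>C\<^esub> h = TAr T p)"
      using Tp \<open>p = q\<close> by (simp add: x_def chi_def prod_pair_def p_def q_def hom_def)
    have x: "x \<in> hom C (TOb T (pob P I I)) (pob P J J)"
      "pr1 P J J \<cdot>\<^bsub>C\<^esub> x = TAr T p" "pr2 P J J \<cdot>\<^bsub>C\<^esub> x = TAr T p"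
      using theI'[OF ex] unfolding xdef by auto
    obtain y where y: "y \<in> hom C (pob P J J) (TOb T (pob P I I))" "x \<cdot>\<^bsub>C\<^esub> y = Idn C (pob P J J)"
    proof -
      have "is_iso C x" using iso I(1) by (simp add: x_def)
      then show ?thesis using that x(1) by (auto simp: is_iso_def inverse_arrows_def hom_def)
    qed
    have h: "pr1 P J J \<in> hom C (pob P J J) J" "pr2 P J J \<in> hom C (pob P J J) J"
      using prJ by (auto simp: is_product_def)
    have eq: "pr1 P J J = pr2 P J J"
      using assoc[OF y(1) x(1) h(1)] assoc[OF y(1) x(1) h(2)] x y(2)
        idn_right[OF h(1)] idn_right[OF h(2)] by simp
    have z: "tzero T I \<in> hom C I J"
      using nat_zero I(1) by (auto simp: nat_trans_def id_funct_def J_def)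
    have "\<exists>!f. f \<in> hom C X J" if X: "X \<in> Ob C" for X
    proof -
      obtain t where "t \<in> hom C X I" using I(2)[OF X] by blast
      then have "tzero T I \<cdot>\<^bsub>C\<^esub> t \<in> hom C X J" using cmp_hom z by blast
      moreover have "f = g" if "f \<in> hom C X J" "g \<in> hom C X J" for f g
        using prJ X that eq unfolding is_product_def by metis
      ultimately show ?thesis by blast
    qed
    then show ?thesis using J by (simp add: is_terminal_def J_def I_def)
  qed
  then show ?thesis by (auto simp: cartesian_tangent_def)
qed

end

theory Submission
  imports Defs
begin

text \<open>
  The inverse of \<open>\<chi>\<close> is determined by \<open>T pr\<^sub>i \<circ> \<chi>\<^sup>-\<^sup>1 = pr\<^sub>i\<close>.  If \<open>\<chi>\<close> is invertible, then the
  arrows \<open>T pr\<^sub>1, T pr\<^sub>2\<close> are jointly monic, and so are \<open>T\<^sup>2 pr\<^sub>1, T\<^sup>2 pr\<^sub>2\<close>.  Hence every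
  compatibility of \<open>\<alpha> = \<chi>\<^sup>-\<^sup>1\<close> with the tangent structure may be checked after composition with
  these arrows, where it becomes naturality of the structure maps at \<open>pr\<^sub>1\<close> and \<open>pr\<^sub>2\<close>.  The
  product functor preserves fibre products because limits commute with limits.
\<close>

section \<open>Fibre powers\<close>

text \<open>A strong morphism presupposes that its source is a Rosicky tangent category, so the
  componentwise structure on the square of the category has to be verified, which takes a large
  share of the work. The obstacle there is that preservation of fibre products and the additivity of
  the flip are demanded for every fibre product, not only for chosen or componentwise ones. It is
  met by splitting an arbitrary limit cone of a product category into limit cones of the two
  factors. Addition is the one structure map for which naturality alone does not suffice: its source
  is a fibre product, so the effect of T_2 pr_i on (\<alpha> x \<alpha>) \<nu> has to be computed on
  legs. The conditions with values in \<open>T (T (X x Y))\<close> use \<chi> at (TX, TY) as well as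
  at (X, Y). The converse implication is short, because the components of a natural isomorphism are
  invertible and preservation of the terminal object follows from that of binary products.\<close>

lemma ex1_eq: "\<exists>!x. Q x \<Longrightarrow> Q x \<Longrightarrow> Q y \<Longrightarrow> x = y"
  by blast

lemma fibre_coneI:
  assumes "f \<in> Ar C" "P \<in> Ob C" "\<And>i. i < k \<Longrightarrow> p i \<in> hom C P (Dom C f)"
    and "\<And>i j. i < k \<Longrightarrow> j < k \<Longrightarrow> f \<cdot>\<^bsub>C\<^esub> p i = f \<cdot>\<^bsub>C\<^esub> p j"
  shows "fibre_cone C k f P p"
  using assms unfolding fibre_cone_def by blast

lemma fibre_coneD:
  assumes "fibre_cone C k f P p"
  shows "f \<in> Ar C" "P \<in> Ob C" "i < k \<Longrightarrow> p i \<in> hom C P (Dom C f)"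
    and "i < k \<Longrightarrow> j < k \<Longrightarrow> f \<cdot>\<^bsub>C\<^esub> p i = f \<cdot>\<^bsub>C\<^esub> p j"
  using assms unfolding fibre_cone_def by blast+

lemma fibre_power_cone: "is_fibre_power C k f P p \<Longrightarrow> fibre_cone C k f P p"
  by (simp add: is_fibre_power_def)

lemma fibre_power_ex1:
  "is_fibre_power C k f P p \<Longrightarrow> fibre_cone C k f Q q \<Longrightarrow>
    \<exists>!h. h \<in> hom C Q P \<and> (\<forall>i<k. p i \<cdot>\<^bsub>C\<^esub> h = q i)"
  by (simp add: is_fibre_power_def)

lemma is_fibre_powerI:
  assumes "fibre_cone C k f P p"
    and "\<And>Q q. fibre_cone C k f Q q \<Longrightarrow> \<exists>!h. h \<in> hom C Q P \<and> (\<forall>i<k. p i \<cdot>\<^bsub>C\<^esub> h = q i)"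
  shows "is_fibre_power C k f P p"
  using assms by (simp add: is_fibre_power_def)

lemma abelian_group_overD:
  assumes "abelian_group_over C f P p P3 r a z"
  shows "is_fibre_power C 2 f P p" "is_fibre_power C 3 f P3 r"
    "a \<in> hom C P (Dom C f)" "f \<cdot>\<^bsub>C\<^esub> a = f \<cdot>\<^bsub>C\<^esub> p 0"
    "z \<in> hom C (Cod C f) (Dom C f)" "f \<cdot>\<^bsub>C\<^esub> z = Idn C (Cod C f)"
  using assms by (simp_all add: abelian_group_over_def)

section \<open>Composition and universal properties inside one category\<close>

context category
begin

text \<open>The locale axioms are phrased with \<open>hom\<close>, whose middle objects the
  simplifier cannot guess. Here and in the next rules typing is split into \<open>Ar\<close>,
  \<open>Dom\<close> and \<open>Cod\<close>, so that side conditions are discharged by rewriting;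
  composites are normalised to the right.\<close>

lemma cmp_ar [simp]:
  assumes "f \<in> Ar C" "g \<in> Ar C" "Cod C f = Dom C g"
  shows "g \<cdot> f \<in> Ar C" "Dom C (g \<cdot> f) = Dom C f" "Cod C (g \<cdot> f) = Cod C g"
  using cmp_hom[of f "Dom C f" "Cod C f" g "Cod C g"] assms by (auto simp: hom_def)

lemma idn_ar [simp]:
  assumes "X \<in> Ob C"
  shows "Idn C X \<in> Ar C" "Dom C (Idn C X) = X" "Cod C (Idn C X) = X"
  using idn_hom[OF assms] by (auto simp: hom_def)

lemma idn_cmp [simp]: "f \<in> Ar C \<Longrightarrow> Cod C f = Y \<Longrightarrow> Idn C Y \<cdot> f = f"
  using idn_left by (auto simp: hom_def)

lemma cmp_idn [simp]: "f \<in> Ar C \<Longrightarrow> Dom C f = X \<Longrightarrow> f \<cdot> Idn C X = f"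
  using idn_right by (auto simp: hom_def)

lemma cmp_assoc [simp]:
  assumes "f \<in> Ar C" "g \<in> Ar C" "h \<in> Ar C" "Cod C f = Dom C g" "Cod C g = Dom C h"
  shows "(h \<cdot> g) \<cdot> f = h \<cdot> (g \<cdot> f)"
  using assoc[of f "Dom C f" "Cod C f" g "Cod C g" h "Cod C h"] assms by (auto simp: hom_def)

declare dom_ob [simp] cod_ob [simp]

text \<open>Uniqueness of two-sided inverses is what gives the definite description
  \<open>inv_arr\<close> a meaning.\<close>

lemma inv_arr_eqI:
  assumes "inverse_arrows C f g"
  shows "inv_arr C f = g"
  unfolding inv_arr_def
proof (rule the_equality)
  show "inverse_arrows C f g" by fact
  fix h assume h: "inverse_arrows C f h"
  have "h = h \<cdot> (f \<cdot> g)" using assms h by (simp add: inverse_arrows_def hom_def)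
  also have "\<dots> = (h \<cdot> f) \<cdot> g"
    using assms h by (subst cmp_assoc) (simp_all add: inverse_arrows_def hom_def)
  also have "\<dots> = g" using assms h by (simp add: inverse_arrows_def hom_def)
  finally show "h = g" .
qed

lemma inv_arr_inverse: "is_iso C f \<Longrightarrow> inverse_arrows C f (inv_arr C f)"
  using inv_arr_eqI by (auto simp: is_iso_def)

lemma fibre_cone_cmp:
  assumes cone: "fibre_cone C k f P p" and h: "h \<in> hom C Q P"
  shows "fibre_cone C k f Q (\<lambda>i. p i \<cdot> h)"
proof (rule fibre_coneI)
  show "f \<in> Ar C" using cone by (rule fibre_coneD)
  show "Q \<in> Ob C" using h by (auto simp: hom_def)
  show "p i \<cdot> h \<in> hom C Q (Dom C f)" if "i < k" for i
    using fibre_coneD(3)[OF cone that] h by (rule cmp_hom[rotated])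
  have "f \<cdot> (p i \<cdot> h) = (f \<cdot> p i) \<cdot> h" if "i < k" for i
    using fibre_coneD(1,3)[OF cone] h that by (subst cmp_assoc) (auto simp: hom_def)
  then show "f \<cdot> (p i \<cdot> h) = f \<cdot> (p j \<cdot> h)" if "i < k" "j < k" for i j
    using fibre_coneD(4)[OF cone that] that by simp
qed

text \<open>A commutative square from \<open>f\<close> to \<open>g\<close> carries cones over
  \<open>f\<close> to cones over \<open>g\<close>. This is the common source of the cones below: the
  base arrow \<open>v\<close> is \<open>f\<close> itself for T_k f, an identity for the flip and for
  \<alpha>, the zero section for the lift, and a projection for products.\<close>

lemma fibre_cone_map:
  assumes cone: "fibre_cone C k f P p" and u: "u \<in> hom C (Dom C f) (Dom C g)"
    and v: "v \<in> hom C (Cod C f) (Cod C g)" and g: "g \<in> Ar C" and comm: "g \<cdot> u = v \<cdot> f"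
  shows "fibre_cone C k g P (\<lambda>i. u \<cdot> p i)"
proof (rule fibre_coneI)
  note c = fibre_coneD[OF cone]
  show "g \<in> Ar C" "P \<in> Ob C" using g c(2) by auto
  show "u \<cdot> p i \<in> hom C P (Dom C g)" if "i < k" for i
    using c(3)[OF that] u by (rule cmp_hom)
  have "g \<cdot> u \<cdot> p i = v \<cdot> f \<cdot> p i" if "i < k" for i
  proof -
    have "g \<cdot> u \<cdot> p i = (g \<cdot> u) \<cdot> p i"
      using c(3)[OF that] u g by (subst cmp_assoc) (auto simp: hom_def)
    also have "\<dots> = v \<cdot> f \<cdot> p i"
      unfolding comm using c(1) c(3)[OF that] v by (subst cmp_assoc) (auto simp: hom_def)
    finally show ?thesis .
  qed
  then show "g \<cdot> u \<cdot> p i = g \<cdot> u \<cdot> p j" if "i < k" "j < k" for i j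
    using c(4)[OF that] that by simp
qed

text \<open>Legs are total functions on the naturals, but only their values below \<open>k\<close>
  are controlled.\<close>

lemma fibre_cone_cong:
  assumes "fibre_cone C k f P p" "\<And>i. i < k \<Longrightarrow> q i = p i"
  shows "fibre_cone C k f P q"
  using assms unfolding fibre_cone_def by metis

lemma induced_hom:
  assumes "is_fibre_power C k f P p" "fibre_cone C k f Q q"
  shows "induced C k P p Q q \<in> hom C Q P"
    and "i < k \<Longrightarrow> p i \<cdot> induced C k P p Q q = q i"
proof -
  from theI'[OF fibre_power_ex1[OF assms]] show "induced C k P p Q q \<in> hom C Q P"
    and "i < k \<Longrightarrow> p i \<cdot> induced C k P p Q q = q i"
    by (auto simp: induced_def)
qed

lemma fibre_power_unique:
  assumes "is_fibre_power C k f P p" "h \<in> hom C Q P" "h' \<in> hom C Q P"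
    and "\<And>i. i < k \<Longrightarrow> p i \<cdot> h = p i \<cdot> h'"
  shows "h = h'"
proof -
  have "fibre_cone C k f Q (\<lambda>i. p i \<cdot> h')"
    using fibre_cone_cmp[OF fibre_power_cone] assms by blast
  from fibre_power_ex1[OF assms(1) this] show ?thesis using assms by blast
qed

text \<open>That \<open>q\<close> is a cone need not be assumed: it agrees with the cone obtained by
  composing the legs \<open>p i\<close> with \<open>h\<close>.\<close>

lemma induced_eqI:
  assumes "is_fibre_power C k f P p" "h \<in> hom C Q P" "\<And>i. i < k \<Longrightarrow> p i \<cdot> h = q i"
  shows "induced C k P p Q q = h"
proof -
  have "fibre_cone C k f Q q"
    by (rule fibre_cone_cong[OF fibre_cone_cmp[OF fibre_power_cone[OF assms(1)] assms(2)]])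
      (simp add: assms(3))
  from induced_hom[OF assms(1) this] show ?thesis
    by (intro fibre_power_unique[OF assms(1) _ assms(2)]) (auto simp: assms(3))
qed

text \<open>The comparison arrows between two limits of one diagram are mutually inverse, since both
  composites act as identities on the legs. Thus one known fibre product settles a claim about all
  of them.\<close>

lemma induced_iso:
  assumes P: "is_fibre_power C k f P p" and Q: "is_fibre_power C k f Q q"
  shows "is_iso C (induced C k P p Q q)"
proof -
  let ?h = "induced C k P p Q q" and ?g = "induced C k Q q P p"
  note cones = fibre_power_cone[OF P] fibre_power_cone[OF Q]
  note obs = fibre_coneD(2)[OF cones(1)] fibre_coneD(2)[OF cones(2)]
  note h = induced_hom[OF P cones(2)] and g = induced_hom[OF Q cones(1)]
  note ar = fibre_coneD(3)[OF cones(1)] fibre_coneD(3)[OF cones(2)]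
  have "?g \<cdot> ?h = Idn C Q"
  proof (rule fibre_power_unique[OF Q])
    show "q i \<cdot> ?g \<cdot> ?h = q i \<cdot> Idn C Q" if "i < k" for i
      using assoc[OF h(1) g(1) ar(2)[OF that]] h(2)[OF that] g(2)[OF that] idn_right[OF ar(2)[OF that]]
      by simp
  qed (use h(1) g(1) obs in \<open>auto simp: hom_def\<close>)
  moreover have "?h \<cdot> ?g = Idn C P"
  proof (rule fibre_power_unique[OF P])
    show "p i \<cdot> ?h \<cdot> ?g = p i \<cdot> Idn C P" if "i < k" for i
      using assoc[OF g(1) h(1) ar(1)[OF that]] h(2)[OF that] g(2)[OF that] idn_right[OF ar(1)[OF that]]
      by simp
  qed (use h(1) g(1) obs in \<open>auto simp: hom_def\<close>)
  ultimately show ?thesis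
    using h(1) g(1) by (auto simp: is_iso_def inverse_arrows_def hom_def)
qed

lemma fibre_cone_pair:
  assumes "f \<in> Ar C" "u \<in> hom C Q (Dom C f)" "v \<in> hom C Q (Dom C f)" "f \<cdot> u = f \<cdot> v"
  shows "fibre_cone C 2 f Q (\<lambda>i. if i = 0 then u else v)"
  using assms by (auto simp: fibre_cone_def hom_def)

lemma fib_pair_hom:
  assumes "is_fibre_power C 2 f P p" "u \<in> hom C Q (Dom C f)" "v \<in> hom C Q (Dom C f)"
    and "f \<cdot> u = f \<cdot> v"
  shows "fib_pair C P p u v \<in> hom C Q P"
    and "p 0 \<cdot> fib_pair C P p u v = u" "p (Suc 0) \<cdot> fib_pair C P p u v = v"
proof -
  note cone = fibre_cone_pair[OF fibre_coneD(1)[OF fibre_power_cone[OF assms(1)]] assms(2-4)]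
  have "Dom C u = Q" using assms by (simp add: hom_def)
  then show "fib_pair C P p u v \<in> hom C Q P" 
    and "p 0 \<cdot> fib_pair C P p u v = u" "p (Suc 0) \<cdot> fib_pair C P p u v = v"
    using induced_hom[OF assms(1) cone] by (auto simp: fib_pair_def)
qed

text \<open>A sum lies over the same base arrow as its summands, because
  \<open>f \<cdot> a = f \<cdot> p 0\<close>. Without this the iterated sums in the associativity
  law could not be paired again.\<close>

lemma abelian_group_add:
  assumes A: "abelian_group_over C f P p P3 r a z"
    and u: "u \<in> hom C Q (Dom C f)" and v: "v \<in> hom C Q (Dom C f)" and uv: "f \<cdot> u = f \<cdot> v"
  shows "a \<cdot> fib_pair C P p u v \<in> hom C Q (Dom C f)"
    and "f \<cdot> a \<cdot> fib_pair C P p u v = f \<cdot> u"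
proof -
  note A' = abelian_group_overD[OF A]
  note pair = fib_pair_hom[OF A'(1) u v uv]
  note cone = fibre_coneD[OF fibre_power_cone[OF A'(1)]]
  show "a \<cdot> fib_pair C P p u v \<in> hom C Q (Dom C f)"
    using pair(1) A'(3) by (rule cmp_hom)
  have f: "f \<in> hom C (Dom C f) (Cod C f)" using cone(1) by (simp add: hom_def)
  have p0: "p 0 \<in> hom C P (Dom C f)" using cone(3) by simp
  show "f \<cdot> a \<cdot> fib_pair C P p u v = f \<cdot> u"
    using assoc[OF pair(1) A'(3) f] assoc[OF pair(1) p0 f] A'(4) pair(2) by simp
qed

end

section \<open>Functors, natural transformations and pointwise inverses\<close>

lemma is_functorD:
  assumes "is_functor C D F"
  shows "category C" "category D"
    and "X \<in> Ob C \<Longrightarrow> FOb F X \<in> Ob D"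
    and "f \<in> Ar C \<Longrightarrow> FAr F f \<in> Ar D"
    and "f \<in> Ar C \<Longrightarrow> Dom D (FAr F f) = FOb F (Dom C f)"
    and "f \<in> Ar C \<Longrightarrow> Cod D (FAr F f) = FOb F (Cod C f)"
    and "X \<in> Ob C \<Longrightarrow> FAr F (Idn C X) = Idn D (FOb F X)"
    and "f \<in> Ar C \<Longrightarrow> g \<in> Ar C \<Longrightarrow> Cod C f = Dom C g \<Longrightarrow>
      FAr F (g \<cdot>\<^bsub>C\<^esub> f) = FAr F g \<cdot>\<^bsub>D\<^esub> FAr F f"
  using assms by (auto simp: is_functor_def hom_def)

lemma functor_hom: "is_functor C D F \<Longrightarrow> f \<in> hom C X Y \<Longrightarrow> FAr F f \<in> hom D (FOb F X) (FOb F Y)"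
  by (auto simp: is_functor_def hom_def)

text \<open>A functor preserves cones even when it does not preserve limits; the image cone is the
  one that induces \<open>nu\<close>.\<close>

lemma fibre_cone_image:
  assumes F: "is_functor C D F" and "fibre_cone C k f P p"
  shows "fibre_cone D k (FAr F f) (FOb F P) (\<lambda>i. FAr F (p i))"
proof (rule fibre_coneI)
  note cone = fibre_coneD[OF assms(2)]
  show "FAr F f \<in> Ar D" "FOb F P \<in> Ob D"
    using is_functorD(3,4)[OF F] cone(1,2) by auto
  show "FAr F (p i) \<in> hom D (FOb F P) (Dom D (FAr F f))" if "i < k" for i
    using functor_hom[OF F cone(3)[OF that]] is_functorD(5)[OF F cone(1)] by simp
  have "FAr F f \<cdot>\<^bsub>D\<^esub> FAr F (p i) = FAr F (f \<cdot>\<^bsub>C\<^esub> p i)" if "i < k" for i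
    using is_functorD(8)[OF F, of "p i" f] cone(1,3) that by (auto simp: hom_def)
  then show "FAr F f \<cdot>\<^bsub>D\<^esub> FAr F (p i) = FAr F f \<cdot>\<^bsub>D\<^esub> FAr F (p j)" if "i < k" "j < k" for i j
    using cone(4)[OF that] that by simp
qed

lemma is_functor_comp:
  "is_functor C D F \<Longrightarrow> is_functor D E G \<Longrightarrow> is_functor C E (comp_funct G F)"
  by (auto simp: is_functor_def comp_funct_def hom_def)

lemma nat_transD:
  assumes "nat_trans C D F G \<alpha>"
  shows "X \<in> Ob C \<Longrightarrow> \<alpha> X \<in> Ar D" "X \<in> Ob C \<Longrightarrow> Dom D (\<alpha> X) = FOb F X"
    "X \<in> Ob C \<Longrightarrow> Cod D (\<alpha> X) = FOb G X"
    "f \<in> Ar C \<Longrightarrow> \<alpha> (Cod C f) \<cdot>\<^bsub>D\<^esub> FAr F f = FAr G f \<cdot>\<^bsub>D\<^esub> \<alpha> (Dom C f)"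
  using assms by (auto simp: nat_trans_def hom_def)

text \<open>Inserting \<alpha> followed by its inverse turns naturality of \<alpha> into naturality
  of the inverse. It will be applied to \<chi>, whose pointwise inverse is the structure map of the
  strong morphism.\<close>

lemma nat_iso_inverse:
  assumes "nat_iso C D F G \<alpha>"
  shows "nat_iso C D G F (\<lambda>X. inv_arr D (\<alpha> X))"
proof -
  have nt: "nat_trans C D F G \<alpha>" and iso: "\<And>X. X \<in> Ob C \<Longrightarrow> is_iso D (\<alpha> X)"
    using assms by (auto simp: nat_iso_def)
  have F: "is_functor C D F" and G: "is_functor C D G" using nt by (auto simp: nat_trans_def)
  interpret C: category C using F by (rule is_functorD)
  interpret D: category D using F by (rule is_functorD)
  note \<alpha> [simp] = nat_transD(1-3)[OF nt]
  have inv: "inverse_arrows D (\<alpha> X) (inv_arr D (\<alpha> X))" if "X \<in> Ob C" for X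
    using iso[OF that] by (rule D.inv_arr_inverse)
  have inv_ar [simp]: "inv_arr D (\<alpha> X) \<in> Ar D" "Dom D (inv_arr D (\<alpha> X)) = FOb G X"
      "Cod D (inv_arr D (\<alpha> X)) = FOb F X"
    and inv_eq [simp]: "\<alpha> X \<cdot>\<^bsub>D\<^esub> inv_arr D (\<alpha> X) = Idn D (FOb G X)"
      "inv_arr D (\<alpha> X) \<cdot>\<^bsub>D\<^esub> \<alpha> X = Idn D (FOb F X)" if "X \<in> Ob C" for X
    using inv[OF that] that by (auto simp: inverse_arrows_def hom_def)
  have "is_iso D (inv_arr D (\<alpha> X))" if "X \<in> Ob C" for X
    using that unfolding is_iso_def inverse_arrows_def
    by (intro exI[of _ "\<alpha> X"]) (auto simp: hom_def)
  moreover have "inv_arr D (\<alpha> (Cod C f)) \<cdot>\<^bsub>D\<^esub> FAr G f = FAr F f \<cdot>\<^bsub>D\<^esub> inv_arr D (\<alpha> (Dom C f))"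
    if f: "f \<in> Ar C" for f
  proof -
    let ?a = "\<alpha> (Dom C f)" and ?b = "\<alpha> (Cod C f)"
    note [simp] = is_functorD(3-6)[OF F] is_functorD(3-6)[OF G]
    have "inv_arr D ?b \<cdot>\<^bsub>D\<^esub> FAr G f = inv_arr D ?b \<cdot>\<^bsub>D\<^esub> FAr G f \<cdot>\<^bsub>D\<^esub> (?a \<cdot>\<^bsub>D\<^esub> inv_arr D ?a)"
      using f by simp
    also have "\<dots> = inv_arr D ?b \<cdot>\<^bsub>D\<^esub> (FAr G f \<cdot>\<^bsub>D\<^esub> ?a) \<cdot>\<^bsub>D\<^esub> inv_arr D ?a"
      using f by (simp del: inv_eq)
    also have "\<dots> = inv_arr D ?b \<cdot>\<^bsub>D\<^esub> (?b \<cdot>\<^bsub>D\<^esub> FAr F f) \<cdot>\<^bsub>D\<^esub> inv_arr D ?a"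
      using nat_transD(4)[OF nt f] by simp
    \<comment> \<open>Pure reassociation: with \<open>inv_eq\<close> active, the bracket on the
      right would contract while the right-nested left side would not.\<close>
    also have "\<dots> = (inv_arr D ?b \<cdot>\<^bsub>D\<^esub> ?b) \<cdot>\<^bsub>D\<^esub> FAr F f \<cdot>\<^bsub>D\<^esub> inv_arr D ?a"
      using f by (simp del: inv_eq)
    also have "\<dots> = FAr F f \<cdot>\<^bsub>D\<^esub> inv_arr D ?a" using f by simp
    finally show ?thesis .
  qed
  ultimately show ?thesis
    using F G by (auto simp: nat_iso_def nat_trans_def hom_def)
qed

section \<open>Products of categories\<close>

lemma prod_cat_simps [simp]:
  "Ob (prod_cat C D) = Ob C \<times> Ob D" "Ar (prod_cat C D) = Ar C \<times> Ar D"
  "Dom (prod_cat C D) (f, g) = (Dom C f, Dom D g)" "Cod (prod_cat C D) (f, g) = (Cod C f, Cod D g)"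
  "Idn (prod_cat C D) (X, Y) = (Idn C X, Idn D Y)"
  "(f', g') \<cdot>\<^bsub>prod_cat C D\<^esub> (f, g) = (f' \<cdot>\<^bsub>C\<^esub> f, g' \<cdot>\<^bsub>D\<^esub> g)"
  by (auto simp: prod_cat_def)

lemma hom_prod_cat [simp]: "hom (prod_cat C D) (X, X') (Y, Y') = hom C X Y \<times> hom D X' Y'"
  by (auto simp: hom_def)

lemma category_prod_cat:
  assumes "category C" "category D"
  shows "category (prod_cat C D)"
proof -
  interpret C: category C by fact
  interpret D: category D by fact
  show ?thesis by unfold_locales (auto simp: C.assoc D.assoc hom_def)
qed

lemma prod_funct_simps [simp]:
  "FOb (prod_funct F G) (X, Y) = (FOb F X, FOb G Y)"
  "FAr (prod_funct F G) (f, g) = (FAr F f, FAr G g)"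
  by (auto simp: prod_funct_def)

lemma comp_funct_simps [simp]:
  "FOb (comp_funct G F) X = FOb G (FOb F X)" "FAr (comp_funct G F) f = FAr G (FAr F f)"
  by (auto simp: comp_funct_def)

lemma id_funct_simps [simp]: "FOb id_funct X = X" "FAr id_funct f = f"
  by (auto simp: id_funct_def)

lemma is_functor_prod:
  assumes F: "is_functor C C' F" and G: "is_functor D D' G"
  shows "is_functor (prod_cat C D) (prod_cat C' D') (prod_funct F G)"
  using category_prod_cat[OF is_functorD(1)[OF F] is_functorD(1)[OF G]]
    category_prod_cat[OF is_functorD(2)[OF F] is_functorD(2)[OF G]]
    is_functorD(3-)[OF F] is_functorD(3-)[OF G]
  by (auto simp: is_functor_def hom_def)

lemma is_functor_cong:
  assumes F: "is_functor C D F" and "\<And>X. X \<in> Ob C \<Longrightarrow> FOb G X = FOb F X"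
    and "\<And>f. f \<in> Ar C \<Longrightarrow> FAr G f = FAr F f"
  shows "is_functor C D G"
proof -
  interpret C: category C using F by (rule is_functorD)
  show ?thesis
    using assms(2,3) is_functorD[OF F] by (auto simp: is_functor_def hom_def)
qed

text \<open>Meant for the addition: T_2 of a product structure is compared with the product of the
  two T_2 only on arrows of the category, since \<open>induced\<close> is a definite description and
  unspecified where there is no cone.\<close>

lemma nat_trans_cong:
  assumes "nat_trans C D F G \<alpha>"
    and "\<And>X. X \<in> Ob C \<Longrightarrow> FOb F' X = FOb F X" "\<And>f. f \<in> Ar C \<Longrightarrow> FAr F' f = FAr F f"
    and "\<And>X. X \<in> Ob C \<Longrightarrow> FOb G' X = FOb G X" "\<And>f. f \<in> Ar C \<Longrightarrow> FAr G' f = FAr G f"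
  shows "nat_trans C D F' G' \<alpha>"
  using assms is_functor_cong[of C D F F'] is_functor_cong[of C D G G'] by (auto simp: nat_trans_def)

lemma nat_trans_prod:
  assumes "nat_trans C C' F G \<alpha>" "nat_trans D D' F' G' \<beta>"
  shows "nat_trans (prod_cat C D) (prod_cat C' D') (prod_funct F F') (prod_funct G G')
    (\<lambda>(X, Y). (\<alpha> X, \<beta> Y))"
  using assms is_functor_prod[of C C' _ D D'] by (auto simp: nat_trans_def)

lemma inverse_arrows_prod [simp]:
  "inverse_arrows (prod_cat C D) (f, f') (g, g') \<longleftrightarrow> inverse_arrows C f g \<and> inverse_arrows D f' g'"
  by (auto simp: inverse_arrows_def)

lemma is_iso_prod [simp]: "is_iso (prod_cat C D) (f, g) \<longleftrightarrow> is_iso C f \<and> is_iso D g"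
  by (auto simp: is_iso_def)

lemma fibre_cone_prod [simp]:
  "fibre_cone (prod_cat C D) k (f, g) (P, Q) (\<lambda>i. (p i, q i)) \<longleftrightarrow>
    fibre_cone C k f P p \<and> fibre_cone D k g Q q"
  unfolding fibre_cone_def by simp blast

lemma is_pullback_prod:
  assumes "is_pullback C f g P u v" "is_pullback D f' g' P' u' v'"
  shows "is_pullback (prod_cat C D) (f, f') (g, g') (P, P') (u, u') (v, v')"
proof -
  have "\<exists>!h. h \<in> hom (prod_cat C D) (Q, Q') (P, P') \<and> (u, u') \<cdot>\<^bsub>prod_cat C D\<^esub> h = (x, x')
      \<and> (v, v') \<cdot>\<^bsub>prod_cat C D\<^esub> h = (y, y')"
    if "Q \<in> Ob C" "x \<in> hom C Q (Dom C f)" "y \<in> hom C Q (Dom C g)" "f \<cdot>\<^bsub>C\<^esub> x = g \<cdot>\<^bsub>C\<^esub> y"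
      "Q' \<in> Ob D" "x' \<in> hom D Q' (Dom D f')" "y' \<in> hom D Q' (Dom D g')" "f' \<cdot>\<^bsub>D\<^esub> x' = g' \<cdot>\<^bsub>D\<^esub> y'"
    for Q Q' x x' y y'
  proof -
    have "\<exists>!h. h \<in> hom C Q P \<and> u \<cdot>\<^bsub>C\<^esub> h = x \<and> v \<cdot>\<^bsub>C\<^esub> h = y"
      "\<exists>!h. h \<in> hom D Q' P' \<and> u' \<cdot>\<^bsub>D\<^esub> h = x' \<and> v' \<cdot>\<^bsub>D\<^esub> h = y'"
      using assms that unfolding is_pullback_def by blast+
    then obtain h h' where
      h: "h \<in> hom C Q P" "u \<cdot>\<^bsub>C\<^esub> h = x" "v \<cdot>\<^bsub>C\<^esub> h = y"
        "\<And>g. g \<in> hom C Q P \<Longrightarrow> u \<cdot>\<^bsub>C\<^esub> g = x \<Longrightarrow> v \<cdot>\<^bsub>C\<^esub> g = y \<Longrightarrow> g = h" and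
      h': "h' \<in> hom D Q' P'" "u' \<cdot>\<^bsub>D\<^esub> h' = x'" "v' \<cdot>\<^bsub>D\<^esub> h' = y'"
        "\<And>g. g \<in> hom D Q' P' \<Longrightarrow> u' \<cdot>\<^bsub>D\<^esub> g = x' \<Longrightarrow> v' \<cdot>\<^bsub>D\<^esub> g = y' \<Longrightarrow> g = h'"
      unfolding Ex1_def by blast
    show ?thesis
      by (rule ex1I[of _ "(h, h')"]) (use h(1-3) h'(1-3) in \<open>auto intro: h(4) h'(4)\<close>)
  qed
  then show ?thesis using assms unfolding is_pullback_def by auto
qed

section \<open>Limits and abelian group objects in a product of two categories\<close>

locale category_pair = C: category C + D: category D
  for C :: "('o, 'a) cat" and D :: "('p, 'b) cat"
begin

sublocale CD: category "prod_cat C D"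
  by (rule category_prod_cat) unfold_locales

lemma inv_arr_prod:
  assumes "is_iso C f" "is_iso D g"
  shows "inv_arr (prod_cat C D) (f, g) = (inv_arr C f, inv_arr D g)"
  by (rule CD.inv_arr_eqI) (simp add: assms C.inv_arr_inverse D.inv_arr_inverse)

text \<open>From right to left, mediating arrows are paired. The other direction is needed because
  the axioms range over all fibre products of the product category, and it lets each of these be
  treated componentwise.\<close>

lemma fibre_power_prod:
  "is_fibre_power (prod_cat C D) k (f, g) (P, Q) (\<lambda>i. (p i, q i)) \<longleftrightarrow>
    is_fibre_power C k f P p \<and> is_fibre_power D k g Q q" (is "?L \<longleftrightarrow> ?R")
proof
  assume R: ?R
  have "\<exists>!h. h \<in> hom (prod_cat C D) S (P, Q) \<and> (\<forall>i<k. (p i, q i) \<cdot>\<^bsub>prod_cat C D\<^esub> h = s i)"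
    if "fibre_cone (prod_cat C D) k (f, g) S s" for S s
  proof -
    obtain S1 S2 s1 s2 where S: "S = (S1, S2)" and s: "s = (\<lambda>i. (s1 i, s2 i))"
      by (rule that[of "fst S" "snd S" "\<lambda>i. fst (s i)" "\<lambda>i. snd (s i)"]) auto
    have "\<exists>!h. h \<in> hom C S1 P \<and> (\<forall>i<k. p i \<cdot>\<^bsub>C\<^esub> h = s1 i)"
      "\<exists>!h. h \<in> hom D S2 Q \<and> (\<forall>i<k. q i \<cdot>\<^bsub>D\<^esub> h = s2 i)"
      using R that by (auto simp: S s intro!: fibre_power_ex1)
    then obtain h1 h2 where
      h1: "h1 \<in> hom C S1 P" "\<forall>i<k. p i \<cdot>\<^bsub>C\<^esub> h1 = s1 i"
        "\<And>h. h \<in> hom C S1 P \<Longrightarrow> \<forall>i<k. p i \<cdot>\<^bsub>C\<^esub> h = s1 i \<Longrightarrow> h = h1" and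
      h2: "h2 \<in> hom D S2 Q" "\<forall>i<k. q i \<cdot>\<^bsub>D\<^esub> h2 = s2 i"
        "\<And>h. h \<in> hom D S2 Q \<Longrightarrow> \<forall>i<k. q i \<cdot>\<^bsub>D\<^esub> h = s2 i \<Longrightarrow> h = h2"
      unfolding Ex1_def by blast
    show ?thesis
      by (rule ex1I[of _ "(h1, h2)"]) (use h1(1,2) h2(1,2) in \<open>auto simp: S s intro: h1(3) h2(3)\<close>)
  qed
  then show ?L using R by (auto simp: is_fibre_power_def)
next
  assume L: ?L
  then have cones: "fibre_cone C k f P p" "fibre_cone D k g Q q"
    by (auto dest: fibre_power_cone)
  then have obs: "P \<in> Ob C" "Q \<in> Ob D" by (auto dest: fibre_coneD(2))
  have qQ: "q i \<cdot>\<^bsub>D\<^esub> Idn D Q = q i" if "i < k" for i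
    using fibre_coneD(3)[OF cones(2) that] by (rule D.idn_right)
  have pP: "p i \<cdot>\<^bsub>C\<^esub> Idn C P = p i" if "i < k" for i
    using fibre_coneD(3)[OF cones(1) that] by (rule C.idn_right)
  have "\<exists>!h. h \<in> hom C S P \<and> (\<forall>i<k. p i \<cdot>\<^bsub>C\<^esub> h = s i)" if "fibre_cone C k f S s" for S s
  proof -
    \<comment> \<open>A cone in one factor alone is no cone in the product; it is completed by the
      given cone \<open>q\<close>, the only one at hand in the other factor.\<close>
    have "fibre_cone (prod_cat C D) k (f, g) (S, Q) (\<lambda>i. (s i, q i))"
      using that cones by simp
    then have ex: "\<exists>!h. h \<in> hom (prod_cat C D) (S, Q) (P, Q) \<and>
        (\<forall>i<k. (p i, q i) \<cdot>\<^bsub>prod_cat C D\<^esub> h = (s i, q i))"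
      by (rule fibre_power_ex1[OF L])
    from ex1_implies_ex[OF this] obtain h where "h \<in> hom C S P \<and> (\<forall>i<k. p i \<cdot>\<^bsub>C\<^esub> h = s i)" by auto
    moreover have "h = h'" if "h \<in> hom C S P \<and> (\<forall>i<k. p i \<cdot>\<^bsub>C\<^esub> h = s i)"
      "h' \<in> hom C S P \<and> (\<forall>i<k. p i \<cdot>\<^bsub>C\<^esub> h' = s i)" for h h'
    proof -
      \<comment> \<open>Padding with the identity makes both candidates mediate the completed cone,
        so its uniqueness transfers to \<open>C\<close>.\<close>
      have "(h, Idn D Q) = (h', Idn D Q)"
        by (rule ex1_eq[OF ex]) (use that D.idn_hom[OF obs(2)] qQ in simp_all)
      then show ?thesis by simp
    qed
    ultimately show ?thesis by blast
  qed
  moreover have "\<exists>!h. h \<in> hom D S Q \<and> (\<forall>i<k. q i \<cdot>\<^bsub>D\<^esub> h = s i)" if "fibre_cone D k g S s" for S s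
  proof -
    have "fibre_cone (prod_cat C D) k (f, g) (P, S) (\<lambda>i. (p i, s i))"
      using that cones by simp
    then have ex: "\<exists>!h. h \<in> hom (prod_cat C D) (P, S) (P, Q) \<and>
        (\<forall>i<k. (p i, q i) \<cdot>\<^bsub>prod_cat C D\<^esub> h = (p i, s i))"
      by (rule fibre_power_ex1[OF L])
    from ex1_implies_ex[OF this] obtain h where "h \<in> hom D S Q \<and> (\<forall>i<k. q i \<cdot>\<^bsub>D\<^esub> h = s i)" by auto
    moreover have "h = h'" if "h \<in> hom D S Q \<and> (\<forall>i<k. q i \<cdot>\<^bsub>D\<^esub> h = s i)"
      "h' \<in> hom D S Q \<and> (\<forall>i<k. q i \<cdot>\<^bsub>D\<^esub> h' = s i)" for h h'
    proof -
      have "(Idn C P, h) = (Idn C P, h')"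
        by (rule ex1_eq[OF ex]) (use that C.idn_hom[OF obs(1)] pP in simp_all)
      then show ?thesis by simp
    qed
    ultimately show ?thesis by blast
  qed
  ultimately show ?R using cones by (auto simp: is_fibre_power_def)
qed

lemma induced_prod:
  assumes "is_fibre_power C k f P p" "is_fibre_power D k g Q q"
    and "fibre_cone C k f R r" "fibre_cone D k g S s"
  shows "induced (prod_cat C D) k (P, Q) (\<lambda>i. (p i, q i)) (R, S) (\<lambda>i. (r i, s i))
    = (induced C k P p R r, induced D k Q q S s)"
  using assms by (intro CD.induced_eqI[of _ "(f, g)"])
    (auto simp: fibre_power_prod C.induced_hom D.induced_hom)

text \<open>The typing assumptions avoid \<open>hom\<close> because this also serves as a
  conditional rewrite rule, where a common source object would be a variable not determined by the
  left-hand side.\<close>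

lemma fib_pair_prod:
  assumes "is_fibre_power C 2 f P p" "is_fibre_power D 2 g Q q"
    and "u \<in> Ar C" "v \<in> Ar C" "Dom C v = Dom C u" "Cod C u = Dom C f" "Cod C v = Dom C f"
      "f \<cdot>\<^bsub>C\<^esub> u = f \<cdot>\<^bsub>C\<^esub> v"
    and "u' \<in> Ar D" "v' \<in> Ar D" "Dom D v' = Dom D u'" "Cod D u' = Dom D g" "Cod D v' = Dom D g"
      "g \<cdot>\<^bsub>D\<^esub> u' = g \<cdot>\<^bsub>D\<^esub> v'"
  shows "fib_pair (prod_cat C D) (P, Q) (\<lambda>i. (p i, q i)) (u, u') (v, v')
    = (fib_pair C P p u v, fib_pair D Q q u' v')"
proof -
  \<comment> \<open>The pair is pulled out of the case distinction, which brings the family into the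
    shape that \<open>induced_prod\<close> expects.\<close>
  have "(\<lambda>i. if i = 0 then (u, u') else (v, v'))
      = (\<lambda>i::nat. (if i = 0 then u else v, if i = 0 then u' else v'))" by auto
  then show ?thesis
    unfolding fib_pair_def prod_cat_simps
    using induced_prod[OF assms(1,2) C.fibre_cone_pair[of f u "Dom C u" v]
        D.fibre_cone_pair[of g u' "Dom D u'" v']] assms
    by (simp add: hom_def fibre_coneD(1)[OF fibre_power_cone])
qed

lemma fib_map_prod:
  assumes "is_fibre_power C k f P p" "is_fibre_power D k f' P' p'"
    and "fibre_cone C k f Q (\<lambda>i. g \<cdot>\<^bsub>C\<^esub> q i)" "fibre_cone D k f' Q' (\<lambda>i. g' \<cdot>\<^bsub>D\<^esub> q' i)"
  shows "fib_map (prod_cat C D) k (g, g') (Q, Q') (\<lambda>i. (q i, q' i)) (P, P') (\<lambda>i. (p i, p' i))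
    = (fib_map C k g Q q P p, fib_map D k g' Q' q' P' p')"
  using induced_prod[OF assms] by (simp add: fib_map_def)

lemma nu_prod:
  assumes "is_functor A C F" "is_functor B D G"
    and "fibre_cone A k f P p" "fibre_cone B k g P' p'"
    and "is_fibre_power C k (FAr F f) Q q" "is_fibre_power D k (FAr G g) Q' q'"
  shows "nu (prod_cat C D) (prod_funct F G) k (P, P') (\<lambda>i. (p i, p' i)) (Q, Q') (\<lambda>i. (q i, q' i))
    = (nu C F k P p Q q, nu D G k P' p' Q' q')"
  using induced_prod[OF assms(5,6) fibre_cone_image[OF assms(1,3)] fibre_cone_image[OF assms(2,4)]]
  by (simp add: nu_def)

text \<open>Existence comes from pairing. For an arbitrary fibre product of the image arrow, its two
  components are fibre products again, and the comparison arrow is the pair of their comparison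
  arrows.\<close>

lemma preserves_fibre_power_prod:
  assumes F: "is_functor A C F" and G: "is_functor B D G"
    and p: "fibre_cone A k f P p" and p': "fibre_cone B k g P' p'"
    and pF: "preserves_fibre_power C F k f P p" and pG: "preserves_fibre_power D G k g P' p'"
  shows "preserves_fibre_power (prod_cat C D) (prod_funct F G) k (f, g) (P, P') (\<lambda>i. (p i, p' i))"
  unfolding preserves_fibre_power_def
proof (intro conjI allI impI)
  obtain Q q Q' q' where "is_fibre_power C k (FAr F f) Q q" "is_fibre_power D k (FAr G g) Q' q'"
    using pF pG by (auto simp: preserves_fibre_power_def)
  then have "is_fibre_power (prod_cat C D) k (FAr (prod_funct F G) (f, g)) (Q, Q') (\<lambda>i. (q i, q' i))"
    by (simp add: fibre_power_prod)
  then show "\<exists>Q q. is_fibre_power (prod_cat C D) k (FAr (prod_funct F G) (f, g)) Q q" by blast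
next
  fix S s assume S: "is_fibre_power (prod_cat C D) k (FAr (prod_funct F G) (f, g)) S s"
  obtain Q Q' q q' where Q: "S = (Q, Q')" "s = (\<lambda>i. (q i, q' i))"
    by (rule that[of "fst S" "snd S" "\<lambda>i. fst (s i)" "\<lambda>i. snd (s i)"]) auto
  have "is_fibre_power C k (FAr F f) Q q" "is_fibre_power D k (FAr G g) Q' q'"
    using S by (simp_all add: Q fibre_power_prod)
  with nu_prod[OF F G p p' this] pF pG
  show "is_iso (prod_cat C D) (nu (prod_cat C D) (prod_funct F G) k (P, P') (\<lambda>i. (p i, p' i)) S s)"
    by (simp add: Q preserves_fibre_power_def)
qed

text \<open>Every group law is an equation between composites of induced arrows, so it splits once
  these arrows do. The effort lies in checking that all paired arrows agree over the base.\<close>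

lemma abelian_group_over_prod:
  assumes A: "abelian_group_over C f P p P3 r a z"
    and A': "abelian_group_over D f' P' p' P3' r' a' z'"
  shows "abelian_group_over (prod_cat C D) (f, f') (P, P') (\<lambda>i. (p i, p' i))
    (P3, P3') (\<lambda>i. (r i, r' i)) (a, a') (z, z')"
proof -
  note fp = abelian_group_overD(1,2)[OF A] abelian_group_overD(1,2)[OF A']
  note c = fibre_power_cone[OF fp(1)] fibre_power_cone[OF fp(2)]
  note c' = fibre_power_cone[OF fp(3)] fibre_power_cone[OF fp(4)]
  note far = fibre_coneD(1)[OF c(1)] fibre_coneD(1)[OF c'(1)]
  note z = abelian_group_overD(5,6)[OF A] abelian_group_overD(5,6)[OF A']
  have p: "p i \<in> hom C P (Dom C f)" "p' i \<in> hom D P' (Dom D f')" if "i < 2" for i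
    using fibre_coneD(3)[OF c(1)] fibre_coneD(3)[OF c'(1)] that by auto
  have pp: "f \<cdot>\<^bsub>C\<^esub> p 1 = f \<cdot>\<^bsub>C\<^esub> p 0" "f' \<cdot>\<^bsub>D\<^esub> p' 1 = f' \<cdot>\<^bsub>D\<^esub> p' 0"
    using fibre_coneD(4)[OF c(1), of 1 0] fibre_coneD(4)[OF c'(1), of 1 0] by auto
  have r: "r i \<in> hom C P3 (Dom C f)" "r' i \<in> hom D P3' (Dom D f')" if "i < 3" for i
    using fibre_coneD(3)[OF c(2)] fibre_coneD(3)[OF c'(2)] that by auto
  have rr: "f \<cdot>\<^bsub>C\<^esub> r 0 = f \<cdot>\<^bsub>C\<^esub> r 1" "f' \<cdot>\<^bsub>D\<^esub> r' 0 = f' \<cdot>\<^bsub>D\<^esub> r' 1"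
    "f \<cdot>\<^bsub>C\<^esub> r 1 = f \<cdot>\<^bsub>C\<^esub> r 2" "f' \<cdot>\<^bsub>D\<^esub> r' 1 = f' \<cdot>\<^bsub>D\<^esub> r' 2"
    using fibre_coneD(4)[OF c(2), of 0 1] fibre_coneD(4)[OF c'(2), of 0 1]
      fibre_coneD(4)[OF c(2), of 1 2] fibre_coneD(4)[OF c'(2), of 1 2] by auto
  obtain n n' where
    n: "n \<in> hom C (Dom C f) (Dom C f)" "f \<cdot>\<^bsub>C\<^esub> n = f"
      "a \<cdot>\<^bsub>C\<^esub> fib_pair C P p n (Idn C (Dom C f)) = z \<cdot>\<^bsub>C\<^esub> f" and
    n': "n' \<in> hom D (Dom D f') (Dom D f')" "f' \<cdot>\<^bsub>D\<^esub> n' = f'"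
      "a' \<cdot>\<^bsub>D\<^esub> fib_pair D P' p' n' (Idn D (Dom D f')) = z' \<cdot>\<^bsub>D\<^esub> f'"
    using A A' by (auto simp: abelian_group_over_def)
  have pair: "fib_pair (prod_cat C D) (P, P') (\<lambda>i. (p i, p' i)) (u, u') (v, v')
      = (fib_pair C P p u v, fib_pair D P' p' u' v')"
    if "u \<in> hom C R (Dom C f)" "v \<in> hom C R (Dom C f)" "f \<cdot>\<^bsub>C\<^esub> u = f \<cdot>\<^bsub>C\<^esub> v"
      "u' \<in> hom D R' (Dom D f')" "v' \<in> hom D R' (Dom D f')" "f' \<cdot>\<^bsub>D\<^esub> u' = f' \<cdot>\<^bsub>D\<^esub> v'" for u v u' v' R R'
    by (rule fib_pair_prod[OF fp(1,3)]) (use that in \<open>auto simp: hom_def\<close>)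
  note add = C.abelian_group_add[OF A] and add' = D.abelian_group_add[OF A']
  have r': "r 0 \<in> hom C P3 (Dom C f)" "r 1 \<in> hom C P3 (Dom C f)" "r 2 \<in> hom C P3 (Dom C f)"
    "r' 0 \<in> hom D P3' (Dom D f')" "r' 1 \<in> hom D P3' (Dom D f')" "r' 2 \<in> hom D P3' (Dom D f')"
    using r by auto
  note r01 = add[OF r'(1,2) rr(1)] add'[OF r'(4,5) rr(2)]
  note r12 = add[OF r'(2,3) rr(3)] add'[OF r'(5,6) rr(4)]
  \<comment> \<open>The two inner and the two outer pairings of the associativity law;
    \<open>r01\<close> and \<open>r12\<close> supply the typing of the inner sums.\<close>
  note eqs = pair[OF r'(1,2) rr(1) r'(4,5) rr(2)] pair[OF r'(2,3) rr(3) r'(5,6) rr(4)]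
    pair[OF r01(1) r'(3) _ r01(3) r'(6)] pair[OF r'(1) r12(1) _ r'(4) r12(3)]
  have p01: "p 0 \<in> hom C P (Dom C f)" "p 1 \<in> hom C P (Dom C f)"
    "p' 0 \<in> hom D P' (Dom D f')" "p' 1 \<in> hom D P' (Dom D f')"
    using p by auto
  \<comment> \<open>The pairings in the commutativity law, the inverse law and the zero law, in this
    order.\<close>
  note eqs' = pair[OF p01(2,1) pp(1) p01(4,3) pp(2)]
    pair[OF n(1) C.idn_hom _ n'(1) D.idn_hom]
    pair[OF C.cmp_hom[OF _ z(1)] C.idn_hom _ D.cmp_hom[OF _ z(3)] D.idn_hom]
  have fh: "f \<in> hom C (Dom C f) (Cod C f)" "f' \<in> hom D (Dom D f') (Cod D f')"
    using far by (auto simp: hom_def)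
  \<comment> \<open>As \<open>z\<close> is a section of \<open>f\<close>, the arrow
    \<open>z \<cdot> f\<close> lies over \<open>f\<close>; this is what allows it to be paired with
    the identity.\<close>
  have fzf: "f \<cdot>\<^bsub>C\<^esub> z \<cdot>\<^bsub>C\<^esub> f = f" "f' \<cdot>\<^bsub>D\<^esub> z' \<cdot>\<^bsub>D\<^esub> f' = f'"
    using C.assoc[OF fh(1) z(1) fh(1)] D.assoc[OF fh(2) z(3) fh(2)] z(2,4) far by simp_all
  have "\<exists>m. m \<in> hom (prod_cat C D) (Dom C f, Dom D f') (Dom C f, Dom D f')
      \<and> (f, f') \<cdot>\<^bsub>prod_cat C D\<^esub> m = (f, f')
      \<and> (a, a') \<cdot>\<^bsub>prod_cat C D\<^esub> fib_pair (prod_cat C D) (P, P') (\<lambda>i. (p i, p' i)) m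
           (Idn C (Dom C f), Idn D (Dom D f'))
         = (z \<cdot>\<^bsub>C\<^esub> f, z' \<cdot>\<^bsub>D\<^esub> f')"
    using n n' far by (intro exI[of _ "(n, n')"]) (simp add: eqs')
  then show ?thesis
    using A A' rr r01 r12 fh
    \<comment> \<open>The simplifier rewrites \<open>1\<close> to \<open>Suc 0\<close> in the goal,
      so the rewrite rules are brought to that form beforehand.\<close>
    by (simp add: abelian_group_over_def fibre_power_prod eqs[unfolded One_nat_def]
        eqs'[unfolded One_nat_def] fzf far)
qed

end

section \<open>Products of Rosicky tangent categories\<close>

lemma tpow_funct_simps [simp]:
  "FOb (tpow_funct C T k) X = tpow T k X"
  "FAr (tpow_funct C T k) f = fib_map C k (TAr T f) (tpow T k (Dom C f)) (tpr T k (Dom C f))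
     (tpow T k (Cod C f)) (tpr T k (Cod C f))"
  by (auto simp: tpow_funct_def)

lemma prod_tangent_simps [simp]:
  "tfun (prod_tangent S T) = prod_funct (tfun S) (tfun T)"
  "tpow (prod_tangent S T) k (X, Y) = (tpow S k X, tpow T k Y)"
  "tpr (prod_tangent S T) k (X, Y) = (\<lambda>i. (tpr S k X i, tpr T k Y i))"
  "tproj (prod_tangent S T) (X, Y) = (tproj S X, tproj T Y)"
  "tzero (prod_tangent S T) (X, Y) = (tzero S X, tzero T Y)"
  "tadd (prod_tangent S T) (X, Y) = (tadd S X, tadd T Y)"
  "tlift (prod_tangent S T) (X, Y) = (tlift S X, tlift T Y)"
  "tflip (prod_tangent S T) (X, Y) = (tflip S X, tflip T Y)"
  by (auto simp: prod_tangent_def)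

context rosicky_tangent_category
begin

lemma T_simps [simp]:
  "X \<in> Ob C \<Longrightarrow> TOb T X \<in> Ob C"
  "f \<in> Ar C \<Longrightarrow> TAr T f \<in> Ar C"
  "f \<in> Ar C \<Longrightarrow> Dom C (TAr T f) = TOb T (Dom C f)"
  "f \<in> Ar C \<Longrightarrow> Cod C (TAr T f) = TOb T (Cod C f)"
  "X \<in> Ob C \<Longrightarrow> TAr T (Idn C X) = Idn C (TOb T X)"
  using is_functorD[OF functor_T] by auto

lemma T_cmp:
  "f \<in> Ar C \<Longrightarrow> g \<in> Ar C \<Longrightarrow> Cod C f = Dom C g \<Longrightarrow> TAr T (g \<cdot> f) = TAr T g \<cdot> TAr T f"
  using is_functorD[OF functor_T] by auto

lemma structure_ar [simp]:
  assumes "X \<in> Ob C"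
  shows "tproj T X \<in> Ar C" "Dom C (tproj T X) = TOb T X" "Cod C (tproj T X) = X"
    "tzero T X \<in> Ar C" "Dom C (tzero T X) = X" "Cod C (tzero T X) = TOb T X"
    "tadd T X \<in> Ar C" "Dom C (tadd T X) = tpow T 2 X" "Cod C (tadd T X) = TOb T X"
    "tlift T X \<in> Ar C" "Dom C (tlift T X) = TOb T X" "Cod C (tlift T X) = TOb T (TOb T X)"
    "tflip T X \<in> Ar C" "Dom C (tflip T X) = TOb T (TOb T X)"
    "Cod C (tflip T X) = TOb T (TOb T X)"
  using nat_transD(1-3)[OF nat_proj assms] nat_transD(1-3)[OF nat_zero assms]
    nat_transD(1-3)[OF nat_add assms] nat_transD(1-3)[OF nat_lift assms]
    nat_transD(1-3)[OF nat_flip assms]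
  by auto

lemma structure_nat:
  assumes "f \<in> Ar C"
  shows "tproj T (Cod C f) \<cdot> TAr T f = f \<cdot> tproj T (Dom C f)"
    "tzero T (Cod C f) \<cdot> f = TAr T f \<cdot> tzero T (Dom C f)"
    "tadd T (Cod C f) \<cdot> FAr (tpow_funct C T 2) f = TAr T f \<cdot> tadd T (Dom C f)"
    "tlift T (Cod C f) \<cdot> TAr T f = TAr T (TAr T f) \<cdot> tlift T (Dom C f)"
    "tflip T (Cod C f) \<cdot> TAr T (TAr T f) = TAr T (TAr T f) \<cdot> tflip T (Dom C f)"
  using nat_transD(4)[OF nat_proj assms] nat_transD(4)[OF nat_zero assms]
    nat_transD(4)[OF nat_add assms] nat_transD(4)[OF nat_lift assms]
    nat_transD(4)[OF nat_flip assms]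
  by (auto simp del: tpow_funct_simps)

lemma tpow_cone: "X \<in> Ob C \<Longrightarrow> 1 \<le> k \<Longrightarrow> fibre_cone C k (tproj T X) (tpow T k X) (tpr T k X)"
  using pow_fibre_power by (rule fibre_power_cone)

lemma tpow_map_cone:
  assumes "f \<in> Ar C" "1 \<le> k"
  shows "fibre_cone C k (tproj T (Cod C f)) (tpow T k (Dom C f)) (\<lambda>i. TAr T f \<cdot> tpr T k (Dom C f) i)"
  by (rule fibre_cone_map[OF tpow_cone, where v = f])
    (use assms structure_nat(1) in \<open>auto simp: hom_def\<close>)

text \<open>Naturality of the projection at itself. It makes \<open>tproj T (TOb T X)\<close> and
  \<open>TAr T (tproj T X)\<close> a pair over \<open>X\<close>, as the pullback axiom for the lift
  tacitly requires.\<close>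

lemma tproj_tproj: "X \<in> Ob C \<Longrightarrow> tproj T X \<cdot> tproj T (TOb T X) = tproj T X \<cdot> TAr T (tproj T X)"
  using structure_nat(1)[of "tproj T X"] by simp

lemma flip_cone:
  assumes "X \<in> Ob C" "fibre_cone C k (TAr T (tproj T X)) Q q"
  shows "fibre_cone C k (tproj T (TOb T X)) Q (\<lambda>i. tflip T X \<cdot> q i)"
  by (rule fibre_cone_map[OF assms(2), where v = "Idn C (TOb T X)"])
    (use assms(1) proj_flip in \<open>auto simp: hom_def\<close>)

lemma lift_cone:
  assumes "X \<in> Ob C"
  shows "fibre_cone C 2 (tproj T (TOb T X)) (tpow T 2 X) (\<lambda>i. tlift T X \<cdot> tpr T 2 X i)"
  by (rule fibre_cone_map[OF tpow_cone, where v = "tzero T X"])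
    (use assms proj_lift in \<open>auto simp: hom_def\<close>)

end

lemma comp_funct_prod:
  "comp_funct (prod_funct F G) (prod_funct F' G') = prod_funct (comp_funct F F') (comp_funct G G')"
  by (auto simp: comp_funct_def prod_funct_def fun_eq_iff)

lemma id_funct_prod: "prod_funct id_funct id_funct = id_funct"
  by (auto simp: id_funct_def prod_funct_def fun_eq_iff)

text \<open>Axioms that are plain equations of structure maps split by simplification. The four
  facts prepared separately contain induced arrows, and these split only in the presence of actual
  cones.\<close>

theorem rosicky_tangent_prod:
  assumes "rosicky_tangent_category C S" "rosicky_tangent_category D T"
  shows "rosicky_tangent_category (prod_cat C D) (prod_tangent S T)"
proof -
  interpret S: rosicky_tangent_category C S by fact
  interpret T: rosicky_tangent_category D T by fact
  interpret category_pair C D ..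
  let ?CD = "prod_cat C D" and ?R = "prod_tangent S T"
  \<comment> \<open>The simplification rules for \<open>prod_tangent\<close> apply to explicit
    pairs, whereas naturality speaks of the transformations as functions.\<close>
  have case_simps: "tproj ?R = (\<lambda>(X, Y). (tproj S X, tproj T Y))"
    "tzero ?R = (\<lambda>(X, Y). (tzero S X, tzero T Y))" "tadd ?R = (\<lambda>(X, Y). (tadd S X, tadd T Y))"
    "tlift ?R = (\<lambda>(X, Y). (tlift S X, tlift T Y))" "tflip ?R = (\<lambda>(X, Y). (tflip S X, tflip T Y))"
    by (auto simp: prod_tangent_def)
  have add_flip: "tadd ?R (TOb ?R (X, Y)) \<cdot>\<^bsub>?CD\<^esub> fib_map ?CD 2 (tflip ?R (X, Y)) U u
        (tpow ?R 2 (TOb ?R (X, Y))) (tpr ?R 2 (TOb ?R (X, Y)))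
      = tflip ?R (X, Y) \<cdot>\<^bsub>?CD\<^esub> TAr ?R (tadd ?R (X, Y)) \<cdot>\<^bsub>?CD\<^esub>
          inv_arr ?CD (nu ?CD (tfun ?R) 2 (tpow ?R 2 (X, Y)) (tpr ?R 2 (X, Y)) U u)"
    if XY: "X \<in> Ob C" "Y \<in> Ob D"
      and U: "is_fibre_power ?CD 2 (TAr ?R (tproj ?R (X, Y))) U u" for X Y U u
  proof -
    obtain Q Q' q q' where Q: "U = (Q, Q')" "u = (\<lambda>i. (q i, q' i))"
      by (rule that[of "fst U" "snd U" "\<lambda>i. fst (u i)" "\<lambda>i. snd (u i)"]) auto
    have q: "is_fibre_power C 2 (TAr S (tproj S X)) Q q" "is_fibre_power D 2 (TAr T (tproj T Y)) Q' q'"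
      using U by (simp_all add: Q fibre_power_prod)
    \<comment> \<open>Invertibility is needed before \<open>inv_arr\<close> may be taken
      componentwise, since it is a definite description.\<close>
    have iso: "is_iso C (nu C (tfun S) 2 (tpow S 2 X) (tpr S 2 X) Q q)"
      "is_iso D (nu D (tfun T) 2 (tpow T 2 Y) (tpr T 2 Y) Q' q')"
      using S.pow_preserved[OF XY(1), of 2] T.pow_preserved[OF XY(2), of 2] q
      by (auto simp: preserves_fibre_power_def)
    show ?thesis
      using S.add_flip[OF XY(1) q(1)] T.add_flip[OF XY(2) q(2)] XY
        fib_map_prod[OF S.pow_fibre_power T.pow_fibre_power S.flip_cone[OF XY(1) fibre_power_cone[OF q(1)]]
          T.flip_cone[OF XY(2) fibre_power_cone[OF q(2)]]]
        nu_prod[OF S.functor_T T.functor_T S.tpow_cone T.tpow_cone q]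
      by (simp add: Q inv_arr_prod[OF iso])
  qed
  have pullback: "is_pullback ?CD
      (fib_pair ?CD (tpow ?R 2 (X, Y)) (tpr ?R 2 (X, Y)) (tproj ?R (TOb ?R (X, Y))) (TAr ?R (tproj ?R (X, Y))))
      (fib_pair ?CD (tpow ?R 2 (X, Y)) (tpr ?R 2 (X, Y)) (tzero ?R (X, Y)) (tzero ?R (X, Y)))
      (TOb ?R (X, Y)) (tlift ?R (X, Y)) (tproj ?R (X, Y))"
    if XY: "X \<in> Ob C" "Y \<in> Ob D" for X Y
    using is_pullback_prod[OF S.lift_pullback[OF XY(1)] T.lift_pullback[OF XY(2)]] XY
    by (simp add: fib_pair_prod[OF S.pow_fibre_power T.pow_fibre_power] S.tproj_tproj T.tproj_tproj)
  have add_lift: "tadd ?R (TOb ?R (X, Y)) \<cdot>\<^bsub>?CD\<^esub> fib_map ?CD 2 (tlift ?R (X, Y)) (tpow ?R 2 (X, Y))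
      (tpr ?R 2 (X, Y)) (tpow ?R 2 (TOb ?R (X, Y))) (tpr ?R 2 (TOb ?R (X, Y)))
    = tlift ?R (X, Y) \<cdot>\<^bsub>?CD\<^esub> tadd ?R (X, Y)" if XY: "X \<in> Ob C" "Y \<in> Ob D" for X Y
    using XY fib_map_prod[OF S.pow_fibre_power T.pow_fibre_power S.lift_cone[OF XY(1)] T.lift_cone[OF XY(2)]]
    by (simp add: S.add_lift T.add_lift)
  have nat_add: "nat_trans ?CD ?CD (tpow_funct ?CD ?R 2) (tfun ?R) (tadd ?R)"
    unfolding case_simps
  proof (rule nat_trans_cong[OF nat_trans_prod[OF S.nat_add T.nat_add]])
    fix h assume "h \<in> Ar ?CD"
    then obtain f g where h: "h = (f, g)" "f \<in> Ar C" "g \<in> Ar D" by auto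
    then show "FAr (tpow_funct ?CD ?R 2) h = FAr (prod_funct (tpow_funct C S 2) (tpow_funct D T 2)) h"
      using fib_map_prod[OF S.pow_fibre_power T.pow_fibre_power S.tpow_map_cone T.tpow_map_cone]
      by simp
  qed auto
  show ?thesis
  proof (intro rosicky_tangent_category.intro rosicky_tangent_category_axioms.intro)
    show "category ?CD" ..
    show "is_functor ?CD ?CD (tfun ?R)"
      using is_functor_prod[OF S.functor_T T.functor_T] by simp
    show "nat_trans ?CD ?CD (tfun ?R) id_funct (tproj ?R)"
      using nat_trans_prod[OF S.nat_proj T.nat_proj] by (simp add: case_simps id_funct_prod)
    show "nat_trans ?CD ?CD id_funct (tfun ?R) (tzero ?R)"
      using nat_trans_prod[OF S.nat_zero T.nat_zero] by (simp add: case_simps id_funct_prod)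
    show "nat_trans ?CD ?CD (tfun ?R) (comp_funct (tfun ?R) (tfun ?R)) (tlift ?R)"
      using nat_trans_prod[OF S.nat_lift T.nat_lift] by (simp add: case_simps comp_funct_prod)
    show "nat_trans ?CD ?CD (comp_funct (tfun ?R) (tfun ?R)) (comp_funct (tfun ?R) (tfun ?R)) (tflip ?R)"
      using nat_trans_prod[OF S.nat_flip T.nat_flip] by (simp add: case_simps comp_funct_prod)
  qed (use nat_add add_flip pullback add_lift in \<open>auto simp: fibre_power_prod S.pow_fibre_power T.pow_fibre_power
      S.flip_flip T.flip_flip S.flip_braid T.flip_braid S.proj_flip T.proj_flip
      S.proj_lift T.proj_lift S.lift_lift T.lift_lift S.flip_lift T.flip_lift
      S.flip_T_lift T.flip_T_lift
      intro!: abelian_group_over_prod S.abelian_group T.abelian_group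
        preserves_fibre_power_prod S.functor_T T.functor_T
        S.tpow_cone T.tpow_cone S.pow_preserved T.pow_preserved\<close>)
qed

section \<open>The product functor\<close>

context category_with_finite_products
begin

abbreviation pmap :: "'a \<Rightarrow> 'a \<Rightarrow> 'a" where
  "pmap f g \<equiv> FAr (product_functor C P) (f, g)"

lemma pr_ar [simp]:
  assumes "X \<in> Ob C" "Y \<in> Ob C"
  shows "pob P X Y \<in> Ob C"
    "pr1 P X Y \<in> Ar C" "Dom C (pr1 P X Y) = pob P X Y" "Cod C (pr1 P X Y) = X"
    "pr2 P X Y \<in> Ar C" "Dom C (pr2 P X Y) = pob P X Y" "Cod C (pr2 P X Y) = Y"
  using binary_product[OF assms] by (auto simp: is_product_def hom_def)

lemma prod_pair:
  assumes "u \<in> hom C Z X" "v \<in> hom C Z Y"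
  shows "prod_pair C P u v \<in> hom C Z (pob P X Y)"
    "pr1 P X Y \<cdot>\<^bsub>C\<^esub> prod_pair C P u v = u" "pr2 P X Y \<cdot>\<^bsub>C\<^esub> prod_pair C P u v = v"
proof -
  have "X \<in> Ob C" "Y \<in> Ob C" "Z \<in> Ob C" using assms by (auto simp: hom_def)
  then have "\<exists>!h. h \<in> hom C Z (pob P X Y) \<and> pr1 P X Y \<cdot>\<^bsub>C\<^esub> h = u \<and> pr2 P X Y \<cdot>\<^bsub>C\<^esub> h = v"
    using binary_product[of X Y] assms unfolding is_product_def by blast
  from theI'[OF this] show "prod_pair C P u v \<in> hom C Z (pob P X Y)"
    "pr1 P X Y \<cdot>\<^bsub>C\<^esub> prod_pair C P u v = u" "pr2 P X Y \<cdot>\<^bsub>C\<^esub> prod_pair C P u v = v"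
    using assms by (simp_all add: prod_pair_def hom_def)
qed

lemma prod_pair_simps [simp]:
  assumes "u \<in> Ar C" "v \<in> Ar C" "Dom C v = Dom C u"
  shows "prod_pair C P u v \<in> Ar C" "Dom C (prod_pair C P u v) = Dom C u"
    "Cod C (prod_pair C P u v) = pob P (Cod C u) (Cod C v)"
    "Cod C u = X \<Longrightarrow> Cod C v = Y \<Longrightarrow> pr1 P X Y \<cdot>\<^bsub>C\<^esub> prod_pair C P u v = u"
    "Cod C u = X \<Longrightarrow> Cod C v = Y \<Longrightarrow> pr2 P X Y \<cdot>\<^bsub>C\<^esub> prod_pair C P u v = v"
  using prod_pair[of u "Dom C u" "Cod C u" v "Cod C v"] assms by (auto simp: hom_def)

lemma prod_eqI:
  assumes "h \<in> hom C Z (pob P X Y)" "h' \<in> hom C Z (pob P X Y)" "X \<in> Ob C" "Y \<in> Ob C"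
    and "pr1 P X Y \<cdot>\<^bsub>C\<^esub> h = pr1 P X Y \<cdot>\<^bsub>C\<^esub> h'" "pr2 P X Y \<cdot>\<^bsub>C\<^esub> h = pr2 P X Y \<cdot>\<^bsub>C\<^esub> h'"
  shows "h = h'"
proof -
  have "Z \<in> Ob C" "pr1 P X Y \<cdot>\<^bsub>C\<^esub> h' \<in> hom C Z X" "pr2 P X Y \<cdot>\<^bsub>C\<^esub> h' \<in> hom C Z Y"
    using assms by (auto simp: hom_def)
  then show ?thesis
    using binary_product[of X Y] assms unfolding is_product_def by metis
qed

lemma product_functor_ob [simp]: "FOb (product_functor C P) (X, Y) = pob P X Y"
  by (simp add: product_functor_def)

lemma pmap_simps [simp]:
  assumes "f \<in> Ar C" "g \<in> Ar C"
  shows "pmap f g \<in> Ar C" "Dom C (pmap f g) = pob P (Dom C f) (Dom C g)"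
    "Cod C (pmap f g) = pob P (Cod C f) (Cod C g)"
    "Cod C f = X \<Longrightarrow> Cod C g = Y \<Longrightarrow> pr1 P X Y \<cdot>\<^bsub>C\<^esub> pmap f g = f \<cdot>\<^bsub>C\<^esub> pr1 P (Dom C f) (Dom C g)"
    "Cod C f = X \<Longrightarrow> Cod C g = Y \<Longrightarrow> pr2 P X Y \<cdot>\<^bsub>C\<^esub> pmap f g = g \<cdot>\<^bsub>C\<^esub> pr2 P (Dom C f) (Dom C g)"
  using assms by (simp_all add: product_functor_def)

text \<open>Right-nested normal forms hide the redex \<open>pr1 \<cdot> pmap\<close> as soon as a
  further factor follows, so each cancellation rule gets a variant with a trailing \<open>h\<close>.
  The later rules ending in \<open>_assoc\<close> have the same purpose.\<close>

lemma pmap_assoc [simp]: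
  assumes "f \<in> Ar C" "g \<in> Ar C" "h \<in> Ar C" "Cod C h = pob P (Dom C f) (Dom C g)"
    "Cod C f = X" "Cod C g = Y"
  shows "pr1 P X Y \<cdot>\<^bsub>C\<^esub> pmap f g \<cdot>\<^bsub>C\<^esub> h = f \<cdot>\<^bsub>C\<^esub> pr1 P (Dom C f) (Dom C g) \<cdot>\<^bsub>C\<^esub> h"
    "pr2 P X Y \<cdot>\<^bsub>C\<^esub> pmap f g \<cdot>\<^bsub>C\<^esub> h = g \<cdot>\<^bsub>C\<^esub> pr2 P (Dom C f) (Dom C g) \<cdot>\<^bsub>C\<^esub> h"
  using assms cmp_assoc[of h "pmap f g" "pr1 P X Y"] cmp_assoc[of h "pmap f g" "pr2 P X Y"]
  by auto

lemma is_functor_product: "is_functor (prod_cat C C) C (product_functor C P)"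
proof -
  have "category (prod_cat C C)" by (rule category_prod_cat) unfold_locales
  moreover have "pmap (Idn C X) (Idn C Y) = Idn C (pob P X Y)" if "X \<in> Ob C" "Y \<in> Ob C" for X Y
    by (rule prod_eqI[of _ "pob P X Y" X Y]) (use that in \<open>auto simp: hom_def\<close>)
  moreover have "pmap (g \<cdot>\<^bsub>C\<^esub> f) (g' \<cdot>\<^bsub>C\<^esub> f') = pmap g g' \<cdot>\<^bsub>C\<^esub> pmap f f'"
    if "f \<in> Ar C" "g \<in> Ar C" "Cod C f = Dom C g" "f' \<in> Ar C" "g' \<in> Ar C" "Cod C f' = Dom C g'"
    for f g f' g'
    by (rule prod_eqI[of _ "pob P (Dom C f) (Dom C f')" "Cod C g" "Cod C g'"])
      (use that in \<open>auto simp: hom_def\<close>)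
  ultimately show ?thesis
    using category_axioms by (auto simp: is_functor_def hom_def)
qed

text \<open>Limits commute with limits: a cone over \<open>pmap f g\<close> is projected to both
  factors, mediated there, and the two mediating arrows are paired.\<close>

lemma fibre_power_product:
  assumes p: "is_fibre_power C k f Q p" and r: "is_fibre_power C k g R r"
  shows "is_fibre_power C k (pmap f g) (pob P Q R) (\<lambda>i. pmap (p i) (r i))"
proof (rule is_fibre_powerI)
  note pc = fibre_power_cone[OF p] and rc = fibre_power_cone[OF r]
  have fg [simp]: "f \<in> Ar C" "g \<in> Ar C" "Q \<in> Ob C" "R \<in> Ob C"
    using fibre_coneD(1,2)[OF pc] fibre_coneD(1,2)[OF rc] by auto
  have legs [simp]: "p i \<in> Ar C" "Dom C (p i) = Q" "Cod C (p i) = Dom C f"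
    "r i \<in> Ar C" "Dom C (r i) = R" "Cod C (r i) = Dom C g" if "i < k" for i
    using fibre_coneD(3)[OF pc that] fibre_coneD(3)[OF rc that] by (auto simp: hom_def)
  have "fibre_cone (prod_cat C C) k (f, g) (Q, R) (\<lambda>i. (p i, r i))"
    using pc rc by simp
  from fibre_cone_image[OF is_functor_product this]
  show "fibre_cone C k (pmap f g) (pob P Q R) (\<lambda>i. pmap (p i) (r i))" by simp
  fix S s assume sc: "fibre_cone C k (pmap f g) S s"
  note s = fibre_coneD[OF sc]
  have s_ar [simp]: "s i \<in> Ar C" "Dom C (s i) = S" "Cod C (s i) = pob P (Dom C f) (Dom C g)" if "i < k" for i
    using s(3)[OF that] by (auto simp: hom_def)
  have cone1: "fibre_cone C k f S (\<lambda>i. pr1 P (Dom C f) (Dom C g) \<cdot>\<^bsub>C\<^esub> s i)"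
    by (rule fibre_cone_map[OF sc, where v = "pr1 P (Cod C f) (Cod C g)"]) (auto simp: hom_def)
  have cone2: "fibre_cone C k g S (\<lambda>i. pr2 P (Dom C f) (Dom C g) \<cdot>\<^bsub>C\<^esub> s i)"
    by (rule fibre_cone_map[OF sc, where v = "pr2 P (Cod C f) (Cod C g)"]) (auto simp: hom_def)
  define h1 where "h1 = induced C k Q p S (\<lambda>i. pr1 P (Dom C f) (Dom C g) \<cdot>\<^bsub>C\<^esub> s i)"
  define h2 where "h2 = induced C k R r S (\<lambda>i. pr2 P (Dom C f) (Dom C g) \<cdot>\<^bsub>C\<^esub> s i)"
  note h1 = induced_hom[OF p cone1, folded h1_def]
  note h2 = induced_hom[OF r cone2, folded h2_def]
  have h_ar [simp]: "h1 \<in> Ar C" "Dom C h1 = S" "Cod C h1 = Q" "h2 \<in> Ar C" "Dom C h2 = S" "Cod C h2 = R"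
    using h1(1) h2(1) by (auto simp: hom_def)
  show "\<exists>!h. h \<in> hom C S (pob P Q R) \<and> (\<forall>i<k. pmap (p i) (r i) \<cdot>\<^bsub>C\<^esub> h = s i)"
  proof (rule ex1I[of _ "prod_pair C P h1 h2"])
    have "pmap (p i) (r i) \<cdot>\<^bsub>C\<^esub> prod_pair C P h1 h2 = s i" if "i < k" for i
      by (rule prod_eqI[of _ S "Dom C f" "Dom C g"])
        (use that h1(2) h2(2) in \<open>auto simp: hom_def\<close>)
    then show "prod_pair C P h1 h2 \<in> hom C S (pob P Q R)
        \<and> (\<forall>i<k. pmap (p i) (r i) \<cdot>\<^bsub>C\<^esub> prod_pair C P h1 h2 = s i)"
      by (simp add: hom_def)
    fix h assume h: "h \<in> hom C S (pob P Q R) \<and> (\<forall>i<k. pmap (p i) (r i) \<cdot>\<^bsub>C\<^esub> h = s i)"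
    have har [simp]: "h \<in> Ar C" "Dom C h = S" "Cod C h = pob P Q R" using h by (auto simp: hom_def)
    \<comment> \<open>Projecting the equation \<open>pmap (p i) (r i) \<cdot> h = s i\<close> shows
      that the components of \<open>h\<close> satisfy the conditions which determine
      \<open>h1\<close> and \<open>h2\<close>.\<close>
    have eq: "p i \<cdot>\<^bsub>C\<^esub> pr1 P Q R \<cdot>\<^bsub>C\<^esub> h = pr1 P (Dom C f) (Dom C g) \<cdot>\<^bsub>C\<^esub> s i"
      "r i \<cdot>\<^bsub>C\<^esub> pr2 P Q R \<cdot>\<^bsub>C\<^esub> h = pr2 P (Dom C f) (Dom C g) \<cdot>\<^bsub>C\<^esub> s i" if "i < k" for i
    proof -
      have "pmap (p i) (r i) \<cdot>\<^bsub>C\<^esub> h = s i" using h that by simp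
      with pmap_assoc[of "p i" "r i" h "Dom C f" "Dom C g"]
      show "p i \<cdot>\<^bsub>C\<^esub> pr1 P Q R \<cdot>\<^bsub>C\<^esub> h = pr1 P (Dom C f) (Dom C g) \<cdot>\<^bsub>C\<^esub> s i"
        "r i \<cdot>\<^bsub>C\<^esub> pr2 P Q R \<cdot>\<^bsub>C\<^esub> h = pr2 P (Dom C f) (Dom C g) \<cdot>\<^bsub>C\<^esub> s i"
        using that by (simp_all del: pmap_assoc)
    qed
    have "pr1 P Q R \<cdot>\<^bsub>C\<^esub> h = h1"
      by (rule fibre_power_unique[OF p _ h1(1)]) (simp_all add: hom_def eq(1) h1(2))
    moreover have "pr2 P Q R \<cdot>\<^bsub>C\<^esub> h = h2"
      by (rule fibre_power_unique[OF r _ h2(1)]) (simp_all add: hom_def eq(2) h2(2))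
    ultimately show "h = prod_pair C P h1 h2"
      by - (rule prod_eqI[of _ S Q R]; simp add: hom_def)
  qed
qed

end

section \<open>Joint monicity and compatibility with the structure maps when \<chi> is
  invertible\<close>

section \<open>Cartesian tangent structures\<close>

text \<open>Invertibility of \<chi> is already equivalent to \<open>cartesian_tangent\<close> by
  \<open>cartesian_iff_chi_iso\<close>, so the terminal object is left out of the
  assumptions.\<close>

locale cartesian_tangent_category =
  category_with_finite_products C P + rosicky_tangent_category C T
  for C :: "('o, 'a) cat" (structure) and P :: "('o, 'a) products" and T :: "('o, 'a) tangent" +
  assumes chi_iso: "X \<in> Ob C \<Longrightarrow> Y \<in> Ob C \<Longrightarrow> is_iso C (chi C P T (X, Y))"
begin

abbreviation \<alpha> :: "'o \<Rightarrow> 'o \<Rightarrow> 'a" where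
  "\<alpha> X Y \<equiv> inv_arr C (chi C P T (X, Y))"

lemma chi_simps [simp]:
  assumes "X \<in> Ob C" "Y \<in> Ob C"
  shows "chi C P T (X, Y) \<in> Ar C" "Dom C (chi C P T (X, Y)) = TOb T (pob P X Y)"
    "Cod C (chi C P T (X, Y)) = pob P (TOb T X) (TOb T Y)"
    "pr1 P (TOb T X) (TOb T Y) \<cdot> chi C P T (X, Y) = TAr T (pr1 P X Y)"
    "pr2 P (TOb T X) (TOb T Y) \<cdot> chi C P T (X, Y) = TAr T (pr2 P X Y)"
  using assms by (simp_all add: chi_def)

lemma chi_assoc [simp]:
  assumes "X \<in> Ob C" "Y \<in> Ob C" "h \<in> Ar C" "Cod C h = TOb T (pob P X Y)"
  shows "pr1 P (TOb T X) (TOb T Y) \<cdot> chi C P T (X, Y) \<cdot> h = TAr T (pr1 P X Y) \<cdot> h"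
    "pr2 P (TOb T X) (TOb T Y) \<cdot> chi C P T (X, Y) \<cdot> h = TAr T (pr2 P X Y) \<cdot> h"
  using assms cmp_assoc[of h "chi C P T (X, Y)" "pr1 P (TOb T X) (TOb T Y)"]
    cmp_assoc[of h "chi C P T (X, Y)" "pr2 P (TOb T X) (TOb T Y)"]
  by simp_all

lemma alpha_simps [simp]:
  assumes "X \<in> Ob C" "Y \<in> Ob C"
  shows "\<alpha> X Y \<in> Ar C" "Dom C (\<alpha> X Y) = pob P (TOb T X) (TOb T Y)"
    "Cod C (\<alpha> X Y) = TOb T (pob P X Y)"
    "chi C P T (X, Y) \<cdot> \<alpha> X Y = Idn C (pob P (TOb T X) (TOb T Y))"
    "\<alpha> X Y \<cdot> chi C P T (X, Y) = Idn C (TOb T (pob P X Y))"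
  using inv_arr_inverse[OF chi_iso[OF assms]] assms by (auto simp: inverse_arrows_def hom_def)

lemma Tpr_alpha [simp]:
  assumes "X \<in> Ob C" "Y \<in> Ob C"
  shows "TAr T (pr1 P X Y) \<cdot> \<alpha> X Y = pr1 P (TOb T X) (TOb T Y)"
    "TAr T (pr2 P X Y) \<cdot> \<alpha> X Y = pr2 P (TOb T X) (TOb T Y)"
  using chi_assoc[OF assms, of "\<alpha> X Y"] assms by (simp_all del: chi_assoc)

lemma Tpr_alpha_assoc [simp]:
  assumes "X \<in> Ob C" "Y \<in> Ob C" "h \<in> Ar C" "Cod C h = pob P (TOb T X) (TOb T Y)"
  shows "TAr T (pr1 P X Y) \<cdot> \<alpha> X Y \<cdot> h = pr1 P (TOb T X) (TOb T Y) \<cdot> h"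
    "TAr T (pr2 P X Y) \<cdot> \<alpha> X Y \<cdot> h = pr2 P (TOb T X) (TOb T Y) \<cdot> h"
  using assms cmp_assoc[of h "\<alpha> X Y" "TAr T (pr1 P X Y)"] cmp_assoc[of h "\<alpha> X Y" "TAr T (pr2 P X Y)"]
  by simp_all

lemma TTpr_Talpha_assoc [simp]:
  assumes "X \<in> Ob C" "Y \<in> Ob C" "h \<in> Ar C" "Cod C h = TOb T (pob P (TOb T X) (TOb T Y))"
  shows "TAr T (TAr T (pr1 P X Y)) \<cdot> TAr T (\<alpha> X Y) \<cdot> h = TAr T (pr1 P (TOb T X) (TOb T Y)) \<cdot> h"
    "TAr T (TAr T (pr2 P X Y)) \<cdot> TAr T (\<alpha> X Y) \<cdot> h = TAr T (pr2 P (TOb T X) (TOb T Y)) \<cdot> h"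
  using assms T_cmp[of "\<alpha> X Y" "TAr T (pr1 P X Y)"] T_cmp[of "\<alpha> X Y" "TAr T (pr2 P X Y)"]
    cmp_assoc[of h "TAr T (\<alpha> X Y)" "TAr T (TAr T (pr1 P X Y))"]
    cmp_assoc[of h "TAr T (\<alpha> X Y)" "TAr T (TAr T (pr2 P X Y))"]
  by simp_all

text \<open>Composing with \<chi> reduces the claim to uniqueness of arrows into
  \<open>TX x TY\<close>, and \<alpha> cancels \<chi> on the left.\<close>

lemma T_prod_eqI:
  assumes XY: "X \<in> Ob C" "Y \<in> Ob C"
    and h: "h \<in> hom C Z (TOb T (pob P X Y))" "h' \<in> hom C Z (TOb T (pob P X Y))"
    and "TAr T (pr1 P X Y) \<cdot> h = TAr T (pr1 P X Y) \<cdot> h'" "TAr T (pr2 P X Y) \<cdot> h = TAr T (pr2 P X Y) \<cdot> h'"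
  shows "h = h'"
proof -
  have "chi C P T (X, Y) \<cdot> h = chi C P T (X, Y) \<cdot> h'"
    by (rule prod_eqI[of _ Z "TOb T X" "TOb T Y"]) (use assms in \<open>auto simp: hom_def\<close>)
  then have "(\<alpha> X Y \<cdot> chi C P T (X, Y)) \<cdot> h = (\<alpha> X Y \<cdot> chi C P T (X, Y)) \<cdot> h'"
    using XY h by (subst (1 2) cmp_assoc) (auto simp: hom_def)
  then show ?thesis using XY h by (simp add: hom_def)
qed

lemma TT_prod_eqI:
  assumes XY: "X \<in> Ob C" "Y \<in> Ob C"
    and h: "h \<in> hom C Z (TOb T (TOb T (pob P X Y)))" "h' \<in> hom C Z (TOb T (TOb T (pob P X Y)))"
    and eq: "TAr T (TAr T (pr1 P X Y)) \<cdot> h = TAr T (TAr T (pr1 P X Y)) \<cdot> h'"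
      "TAr T (TAr T (pr2 P X Y)) \<cdot> h = TAr T (TAr T (pr2 P X Y)) \<cdot> h'"
  shows "h = h'"
proof -
  let ?x = "TAr T (chi C P T (X, Y))"
  have pr: "TAr T (pr1 P (TOb T X) (TOb T Y)) \<cdot> ?x \<cdot> k = TAr T (TAr T (pr1 P X Y)) \<cdot> k"
    "TAr T (pr2 P (TOb T X) (TOb T Y)) \<cdot> ?x \<cdot> k = TAr T (TAr T (pr2 P X Y)) \<cdot> k"
    if "k \<in> hom C Z (TOb T (TOb T (pob P X Y)))" for k
    using that XY T_cmp[of "chi C P T (X, Y)" "pr1 P (TOb T X) (TOb T Y)"]
      T_cmp[of "chi C P T (X, Y)" "pr2 P (TOb T X) (TOb T Y)"]
      cmp_assoc[of k ?x "TAr T (pr1 P (TOb T X) (TOb T Y))"]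
      cmp_assoc[of k ?x "TAr T (pr2 P (TOb T X) (TOb T Y))"]
    by (simp_all add: hom_def)
  \<comment> \<open>The arrow T\<chi> ends in \<open>T (TX x TY)\<close>, so the previous lemma is
    applied at the objects TX and TY.\<close>
  have "?x \<cdot> h = ?x \<cdot> h'"
    by (rule T_prod_eqI[of "TOb T X" "TOb T Y" _ Z])
      (use XY h eq pr[OF h(1)] pr[OF h(2)] in \<open>auto simp: hom_def\<close>)
  then have "(TAr T (\<alpha> X Y) \<cdot> ?x) \<cdot> h = (TAr T (\<alpha> X Y) \<cdot> ?x) \<cdot> h'"
    using XY h by (subst (1 2) cmp_assoc) (auto simp: hom_def)
  moreover have "TAr T (\<alpha> X Y) \<cdot> ?x = Idn C (TOb T (TOb T (pob P X Y)))"
    using XY by (simp flip: T_cmp)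
  \<comment> \<open>Reassociation is switched off so that the composite of T\<alpha> and T\<chi>
    stays bracketed and is replaced by the identity.\<close>
  ultimately show ?thesis using XY h by (simp add: hom_def del: cmp_assoc)
qed

text \<open>After projection, naturality of \<chi> is the image under \<open>T\<close> of the
  equations that define \<open>pmap f g\<close>.\<close>

lemma nat_iso_chi:
  "nat_iso (prod_cat C C) C (comp_funct (tfun T) (product_functor C P))
    (comp_funct (product_functor C P) (prod_funct (tfun T) (tfun T))) (chi C P T)"
proof -
  have "is_functor (prod_cat C C) C (comp_funct (tfun T) (product_functor C P))"
    "is_functor (prod_cat C C) C (comp_funct (product_functor C P) (prod_funct (tfun T) (tfun T)))"
    using is_functor_comp is_functor_product functor_T is_functor_prod by blast+
  moreover have "chi C P T (Cod C f, Cod C g) \<cdot> TAr T (pmap f g)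
      = pmap (TAr T f) (TAr T g) \<cdot> chi C P T (Dom C f, Dom C g)"
    if fg: "f \<in> Ar C" "g \<in> Ar C" for f g
  proof (rule prod_eqI[of _ "TOb T (pob P (Dom C f) (Dom C g))" "TOb T (Cod C f)" "TOb T (Cod C g)"])
    have "TAr T (pr1 P (Cod C f) (Cod C g)) \<cdot> TAr T (pmap f g) = TAr T f \<cdot> TAr T (pr1 P (Dom C f) (Dom C g))"
      "TAr T (pr2 P (Cod C f) (Cod C g)) \<cdot> TAr T (pmap f g) = TAr T g \<cdot> TAr T (pr2 P (Dom C f) (Dom C g))"
      using fg by (simp_all flip: T_cmp)
    then show "pr1 P (TOb T (Cod C f)) (TOb T (Cod C g)) \<cdot> chi C P T (Cod C f, Cod C g) \<cdot> TAr T (pmap f g)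
        = pr1 P (TOb T (Cod C f)) (TOb T (Cod C g)) \<cdot> pmap (TAr T f) (TAr T g) \<cdot> chi C P T (Dom C f, Dom C g)"
      "pr2 P (TOb T (Cod C f)) (TOb T (Cod C g)) \<cdot> chi C P T (Cod C f, Cod C g) \<cdot> TAr T (pmap f g)
        = pr2 P (TOb T (Cod C f)) (TOb T (Cod C g)) \<cdot> pmap (TAr T f) (TAr T g) \<cdot> chi C P T (Dom C f, Dom C g)"
      using fg by simp_all
  qed (use fg in \<open>auto simp: hom_def\<close>)
  ultimately show ?thesis
    by (auto simp: nat_iso_def nat_trans_def chi_iso hom_def)
qed

text \<open>The common target is \<open>X x Y\<close> itself, so the ordinary projections decide:
  naturality of the projection moves T pr_i next to \<alpha>, where it cancels.\<close>

lemma proj_alpha: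
  assumes XY [simp]: "X \<in> Ob C" "Y \<in> Ob C"
  shows "tproj T (pob P X Y) \<cdot> \<alpha> X Y = pmap (tproj T X) (tproj T Y)"
proof (rule prod_eqI[of _ "pob P (TOb T X) (TOb T Y)" X Y])
  have "(pr1 P X Y \<cdot> tproj T (pob P X Y)) \<cdot> \<alpha> X Y = (tproj T X \<cdot> TAr T (pr1 P X Y)) \<cdot> \<alpha> X Y"
    "(pr2 P X Y \<cdot> tproj T (pob P X Y)) \<cdot> \<alpha> X Y = (tproj T Y \<cdot> TAr T (pr2 P X Y)) \<cdot> \<alpha> X Y"
    using structure_nat(1)[of "pr1 P X Y"] structure_nat(1)[of "pr2 P X Y"] by simp_all
  then show "pr1 P X Y \<cdot> tproj T (pob P X Y) \<cdot> \<alpha> X Y = pr1 P X Y \<cdot> pmap (tproj T X) (tproj T Y)"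
    "pr2 P X Y \<cdot> tproj T (pob P X Y) \<cdot> \<alpha> X Y = pr2 P X Y \<cdot> pmap (tproj T X) (tproj T Y)"
    by simp_all
qed (auto simp: hom_def)

text \<open>The target is \<open>T (T (X x Y))\<close>, hence the test arrows T(T pr_i). They strip
  T\<alpha> and then \<alpha> from the right side, leaving the lift after pr_i; naturality of the
  lift gives the same on the left.\<close>

lemma lift_alpha:
  assumes XY [simp]: "X \<in> Ob C" "Y \<in> Ob C"
  shows "tlift T (pob P X Y) \<cdot> \<alpha> X Y
    = TAr T (\<alpha> X Y) \<cdot> \<alpha> (TOb T X) (TOb T Y) \<cdot> pmap (tlift T X) (tlift T Y)"
proof (rule TT_prod_eqI[of X Y _ "pob P (TOb T X) (TOb T Y)"])
  have "(TAr T (TAr T (pr1 P X Y)) \<cdot> tlift T (pob P X Y)) \<cdot> \<alpha> X Y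
      = (tlift T X \<cdot> TAr T (pr1 P X Y)) \<cdot> \<alpha> X Y"
    "(TAr T (TAr T (pr2 P X Y)) \<cdot> tlift T (pob P X Y)) \<cdot> \<alpha> X Y
      = (tlift T Y \<cdot> TAr T (pr2 P X Y)) \<cdot> \<alpha> X Y"
    using structure_nat(4)[of "pr1 P X Y"] structure_nat(4)[of "pr2 P X Y"] by simp_all
  then show "TAr T (TAr T (pr1 P X Y)) \<cdot> tlift T (pob P X Y) \<cdot> \<alpha> X Y
      = TAr T (TAr T (pr1 P X Y)) \<cdot> TAr T (\<alpha> X Y) \<cdot> \<alpha> (TOb T X) (TOb T Y) \<cdot> pmap (tlift T X) (tlift T Y)"
    "TAr T (TAr T (pr2 P X Y)) \<cdot> tlift T (pob P X Y) \<cdot> \<alpha> X Y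
      = TAr T (TAr T (pr2 P X Y)) \<cdot> TAr T (\<alpha> X Y) \<cdot> \<alpha> (TOb T X) (TOb T Y) \<cdot> pmap (tlift T X) (tlift T Y)"
    by simp_all
qed (auto simp: hom_def)

lemma flip_alpha:
  assumes XY [simp]: "X \<in> Ob C" "Y \<in> Ob C"
  shows "tflip T (pob P X Y) \<cdot> TAr T (\<alpha> X Y) \<cdot> \<alpha> (TOb T X) (TOb T Y)
    = TAr T (\<alpha> X Y) \<cdot> \<alpha> (TOb T X) (TOb T Y) \<cdot> pmap (tflip T X) (tflip T Y)"
proof (rule TT_prod_eqI[of X Y _ "pob P (TOb T (TOb T X)) (TOb T (TOb T Y))"])
  let ?a = "TAr T (\<alpha> X Y) \<cdot> \<alpha> (TOb T X) (TOb T Y)"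
  have "(TAr T (TAr T (pr1 P X Y)) \<cdot> tflip T (pob P X Y)) \<cdot> ?a
      = (tflip T X \<cdot> TAr T (TAr T (pr1 P X Y))) \<cdot> ?a"
    "(TAr T (TAr T (pr2 P X Y)) \<cdot> tflip T (pob P X Y)) \<cdot> ?a
      = (tflip T Y \<cdot> TAr T (TAr T (pr2 P X Y))) \<cdot> ?a"
    using structure_nat(5)[of "pr1 P X Y"] structure_nat(5)[of "pr2 P X Y"] by simp_all
  then show "TAr T (TAr T (pr1 P X Y)) \<cdot> tflip T (pob P X Y) \<cdot> ?a
      = TAr T (TAr T (pr1 P X Y)) \<cdot> TAr T (\<alpha> X Y) \<cdot> \<alpha> (TOb T X) (TOb T Y) \<cdot> pmap (tflip T X) (tflip T Y)"
    "TAr T (TAr T (pr2 P X Y)) \<cdot> tflip T (pob P X Y) \<cdot> ?a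
      = TAr T (TAr T (pr2 P X Y)) \<cdot> TAr T (\<alpha> X Y) \<cdot> \<alpha> (TOb T X) (TOb T Y) \<cdot> pmap (tflip T X) (tflip T Y)"
    by simp_all
qed (auto simp: hom_def)

text \<open>With \<open>m\<close> for \<alpha> x \<alpha> and \<open>n\<close> for \<nu>, naturality
  of addition turns T pr_i after the left side into addition after
  \<open>T_2 pr_i \<cdot> m \<cdot> n\<close>. That composite is the projection of
  \<open>T_2 X x T_2 Y\<close>, as its legs show, and T pr_i \<alpha> on the right side also yields
  a projection.\<close>

lemma add_alpha:
  assumes XY [simp]: "X \<in> Ob C" "Y \<in> Ob C"
    and q: "is_fibre_power C 2 (pmap (tproj T X) (tproj T Y)) Q q"
  shows "tadd T (pob P X Y) \<cdot> fib_map C 2 (\<alpha> X Y) Q q (tpow T 2 (pob P X Y)) (tpr T 2 (pob P X Y))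
      \<cdot> nu C (product_functor C P) 2 (tpow T 2 X, tpow T 2 Y) (\<lambda>i. (tpr T 2 X i, tpr T 2 Y i)) Q q
    = \<alpha> X Y \<cdot> pmap (tadd T X) (tadd T Y)"
proof -
  define m where "m = fib_map C 2 (\<alpha> X Y) Q q (tpow T 2 (pob P X Y)) (tpr T 2 (pob P X Y))"
  define n where "n = nu C (product_functor C P) 2 (tpow T 2 X, tpow T 2 Y)
    (\<lambda>i. (tpr T 2 X i, tpr T 2 Y i)) Q q"
  have tpow2 [simp]: "tpow T 2 Z \<in> Ob C" if "Z \<in> Ob C" for Z
    using fibre_coneD(2)[OF tpow_cone[OF that, of 2]] by simp
  have tpr2 [simp]: "tpr T 2 Z i \<in> Ar C" "Dom C (tpr T 2 Z i) = tpow T 2 Z"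
    "Cod C (tpr T 2 Z i) = TOb T Z" if "Z \<in> Ob C" "i < 2" for Z i
    using fibre_coneD(3)[OF tpow_cone, of Z 2 i] that by (auto simp: hom_def)
  note qc = fibre_power_cone[OF q]
  have q_ar [simp]: "q i \<in> Ar C" "Dom C (q i) = Q" "Cod C (q i) = pob P (TOb T X) (TOb T Y)" if "i < 2" for i
    using fibre_coneD(3)[OF qc that] by (auto simp: hom_def)
  \<comment> \<open>The square has the identity as base arrow because \<alpha> commutes with the
    projections by \<open>proj_alpha\<close>.\<close>
  have cone: "fibre_cone C 2 (tproj T (pob P X Y)) Q (\<lambda>i. \<alpha> X Y \<cdot> q i)"
    by (rule fibre_cone_map[OF qc, where v = "Idn C (pob P X Y)"]) (auto simp: hom_def proj_alpha)
  have m: "m \<in> hom C Q (tpow T 2 (pob P X Y))" "i < 2 \<Longrightarrow> tpr T 2 (pob P X Y) i \<cdot> m = \<alpha> X Y \<cdot> q i" for i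
    unfolding m_def fib_map_def by (rule induced_hom[OF pow_fibre_power cone]; simp)+
  have "fibre_cone (prod_cat C C) 2 (tproj T X, tproj T Y) (tpow T 2 X, tpow T 2 Y)
      (\<lambda>i. (tpr T 2 X i, tpr T 2 Y i))"
    using tpow_cone[of X 2] tpow_cone[of Y 2] by simp
  note cone' = fibre_cone_image[OF is_functor_product this]
  have n: "n \<in> hom C (pob P (tpow T 2 X) (tpow T 2 Y)) Q"
    "i < 2 \<Longrightarrow> q i \<cdot> n = pmap (tpr T 2 X i) (tpr T 2 Y i)" for i
    using induced_hom[OF q cone'] by (simp_all add: n_def nu_def)
  have mn_ar [simp]: "m \<in> Ar C" "Dom C m = Q" "Cod C m = tpow T 2 (pob P X Y)"
    "n \<in> Ar C" "Dom C n = pob P (tpow T 2 X) (tpow T 2 Y)" "Cod C n = Q"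
    using m(1) n(1) by (auto simp: hom_def)
  \<comment> \<open>The legs of \<open>m \<cdot> n\<close> no longer involve the arbitrary fibre
    product \<open>Q\<close>, through which the composite passes.\<close>
  have mn: "tpr T 2 (pob P X Y) i \<cdot> m \<cdot> n = \<alpha> X Y \<cdot> pmap (tpr T 2 X i) (tpr T 2 Y i)" if "i < 2" for i
  proof -
    have "tpr T 2 (pob P X Y) i \<cdot> m \<cdot> n = (tpr T 2 (pob P X Y) i \<cdot> m) \<cdot> n"
      using that by (subst cmp_assoc) simp_all
    also have "\<dots> = \<alpha> X Y \<cdot> q i \<cdot> n" using that by (simp add: m(2))
    finally show ?thesis using that by (simp add: n(2))
  qed
  \<comment> \<open>Stated for a general \<open>f\<close> out of \<open>X x Y\<close> so that one
    argument serves both projections; \<open>g\<close> is the expected value of the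
    composite.\<close>
  have T2: "FAr (tpow_funct C T 2) f \<cdot> m \<cdot> n = g"
    if f: "f \<in> Ar C" "Dom C f = pob P X Y" and g: "g \<in> hom C (pob P (tpow T 2 X) (tpow T 2 Y)) (tpow T 2 (Cod C f))"
      and eq: "\<And>i. i < 2 \<Longrightarrow> TAr T f \<cdot> \<alpha> X Y \<cdot> pmap (tpr T 2 X i) (tpr T 2 Y i) = tpr T 2 (Cod C f) i \<cdot> g"
    for f g
  proof -
    have fp: "is_fibre_power C 2 (tproj T (Cod C f)) (tpow T 2 (Cod C f)) (tpr T 2 (Cod C f))"
      using f by (intro pow_fibre_power) auto
    define t where "t = FAr (tpow_funct C T 2) f"
    have t: "t \<in> hom C (tpow T 2 (pob P X Y)) (tpow T 2 (Cod C f))"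
      "i < 2 \<Longrightarrow> tpr T 2 (Cod C f) i \<cdot> t = TAr T f \<cdot> tpr T 2 (pob P X Y) i" for i
      using induced_hom[OF fp tpow_map_cone[OF f(1)]] f by (simp_all add: t_def fib_map_def)
    have t_ar [simp]: "t \<in> Ar C" "Dom C t = tpow T 2 (pob P X Y)" "Cod C t = tpow T 2 (Cod C f)"
      using t(1) by (auto simp: hom_def)
    have "tpr T 2 (Cod C f) i \<cdot> t \<cdot> m \<cdot> n = tpr T 2 (Cod C f) i \<cdot> g" if "i < 2" for i
    proof -
      have "tpr T 2 (Cod C f) i \<cdot> t \<cdot> m \<cdot> n = (tpr T 2 (Cod C f) i \<cdot> t) \<cdot> m \<cdot> n"
        using that f by (subst cmp_assoc) simp_all
      also have "\<dots> = TAr T f \<cdot> \<alpha> X Y \<cdot> pmap (tpr T 2 X i) (tpr T 2 Y i)"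
        using that f by (simp add: t(2) mn)
      finally show ?thesis using eq[OF that] by simp
    qed
    then have "t \<cdot> m \<cdot> n = g"
      by (intro fibre_power_unique[OF fp _ g]) (auto simp: hom_def)
    then show ?thesis by (simp add: t_def)
  qed
  have T2_pr: "FAr (tpow_funct C T 2) (pr1 P X Y) \<cdot> m \<cdot> n = pr1 P (tpow T 2 X) (tpow T 2 Y)"
    "FAr (tpow_funct C T 2) (pr2 P X Y) \<cdot> m \<cdot> n = pr2 P (tpow T 2 X) (tpow T 2 Y)"
    by (rule T2; simp add: hom_def)+
  \<comment> \<open>Typing comes from functoriality of T_2, which is contained in
    \<open>nat_add\<close>; the unfolding rule is disabled to keep T_2 f folded.\<close>
  have T2_ar: "FAr (tpow_funct C T 2) f \<in> Ar C" "Dom C (FAr (tpow_funct C T 2) f) = tpow T 2 (Dom C f)"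
    "Cod C (FAr (tpow_funct C T 2) f) = tpow T 2 (Cod C f)" if "f \<in> Ar C" for f
    using nat_add is_functorD(4-6)[of C C "tpow_funct C T 2" f] that
    by (auto simp: nat_trans_def simp del: tpow_funct_simps(2))
  have add_pr: "TAr T f \<cdot> tadd T (pob P X Y) \<cdot> m \<cdot> n = tadd T (Cod C f) \<cdot> FAr (tpow_funct C T 2) f \<cdot> m \<cdot> n"
    if f: "f \<in> Ar C" "Dom C f = pob P X Y" for f
  proof -
    have "TAr T f \<cdot> tadd T (pob P X Y) \<cdot> m \<cdot> n = (TAr T f \<cdot> tadd T (pob P X Y)) \<cdot> m \<cdot> n"
      using f by (subst cmp_assoc) simp_all
    also have "\<dots> = (tadd T (Cod C f) \<cdot> FAr (tpow_funct C T 2) f) \<cdot> m \<cdot> n"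
      using structure_nat(3)[OF f(1)] f(2) by simp
    also have "\<dots> = tadd T (Cod C f) \<cdot> FAr (tpow_funct C T 2) f \<cdot> m \<cdot> n"
      using f by (subst cmp_assoc) (simp_all add: T2_ar del: tpow_funct_simps(2))
    finally show ?thesis .
  qed
  have "tadd T (pob P X Y) \<cdot> m \<cdot> n = \<alpha> X Y \<cdot> pmap (tadd T X) (tadd T Y)"
    by (rule T_prod_eqI[of X Y _ "pob P (tpow T 2 X) (tpow T 2 Y)"])
      (simp_all add: hom_def add_pr T2_pr del: tpow_funct_simps(2))
  then show ?thesis by (simp add: m_def n_def)
qed

text \<open>The product of the two fibre products is a fibre product of the image arrow. This gives
  existence, and \<nu> is by definition the comparison of it with any other choice, hence
  invertible.\<close>

lemma product_preserves_tpow: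
  assumes "X \<in> Ob C" "Y \<in> Ob C" "1 \<le> k"
  shows "preserves_fibre_power C (product_functor C P) k (tproj T X, tproj T Y)
    (tpow T k X, tpow T k Y) (\<lambda>i. (tpr T k X i, tpr T k Y i))"
proof -
  note fp = fibre_power_product[OF pow_fibre_power[OF assms(1,3)] pow_fibre_power[OF assms(2,3)]]
  then show ?thesis
    unfolding preserves_fibre_power_def using induced_iso[OF _ fp] by (auto simp: nu_def)
qed

theorem strong_morphism_product:
  "strong_morphism (prod_cat C C) (prod_tangent T T) C T (product_functor C P)
    (\<lambda>XY. inv_arr C (chi C P T XY))"
proof (intro strong_morphism.intro strong_morphism_axioms.intro)
  show "rosicky_tangent_category C T" ..
  then show "rosicky_tangent_category (prod_cat C C) (prod_tangent T T)"
    by (intro rosicky_tangent_prod)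
  show "is_functor (prod_cat C C) C (product_functor C P)"
    by (rule is_functor_product)
  show "nat_iso (prod_cat C C) C (comp_funct (product_functor C P) (tfun (prod_tangent T T)))
      (comp_funct (tfun T) (product_functor C P)) (\<lambda>XY. inv_arr C (chi C P T XY))"
    using nat_iso_inverse[OF nat_iso_chi] by simp
qed (auto simp: product_preserves_tpow proj_alpha add_alpha lift_alpha flip_alpha)

end

theorem proposition3p7:
  fixes C :: "('o, 'a) cat" and P :: "('o, 'a) products" and T :: "('o, 'a) tangent"
  assumes "category_with_finite_products C P"
    and "rosicky_tangent_category C T"
  shows "cartesian_tangent C P T \<longleftrightarrow>
    nat_iso (prod_cat C C) C
      (comp_funct (tfun T) (product_functor C P))
      (comp_funct (product_functor C P) (prod_funct (tfun T) (tfun T)))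
      (chi C P T)
    \<and> strong_morphism (prod_cat C C) (prod_tangent T T) C T
        (product_functor C P) (\<lambda>XY. inv_arr C (chi C P T XY))"
  (is "_ \<longleftrightarrow> ?nat_iso \<and> ?strong")
proof
  assume "cartesian_tangent C P T"
  then interpret cartesian_tangent_category C P T
    using assms by (intro cartesian_tangent_category.intro cartesian_tangent_category_axioms.intro)
      (auto simp: cartesian_iff_chi_iso)
  show "?nat_iso \<and> ?strong"
    using nat_iso_chi strong_morphism_product by blast
next
  assume "?nat_iso \<and> ?strong"
  \<comment> \<open>Only the components of the natural isomorphism are used;
    \<open>cartesian_iff_chi_iso\<close> supplies the terminal object.\<close>
  then show "cartesian_tangent C P T"
    using assms by (auto simp: cartesian_iff_chi_iso nat_iso_def)
qed

end
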